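(* Let $m$ be a positive integer, let $\mu\subseteq\lambda$ be partitions with $\ell(\lambda)\le m$, and suppose $|\lambda/\mu|=n$ where $n$ is odd. Suppose that $\gcd(m,p)=1$ for every odd prime $p\le n$. Let $\langle g\rangle$ be a cyclic group of order $2m$ that acts on the set $SP(\lambda/\mu,2m)$ of Kashiwara–Nakashima skew symplectic tableaux with the property that, for every $T\in SP(\lambda/\mu,2m)$ with $\mathrm{wt}(T)=(\chi_1,\ldots,\chi_m)$, one has $\mathrm{wt}(gT)=(-\chi_m,\chi_1,\ldots,\chi_{m-1})$. Let $X(q)=\sum_{T\in SP(\lambda/\mu,2m)}q^{\mathrm{pwr}(T)}$. Then the triple $(SP(\lambda/\mu,2m),\langle g\rangle,X(q))$ exhibits the cyclic sieving phenomenon.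
   Context: Cyclic sieving phenomenon: for a finite set $Y$, a cyclic group $\langle g\rangle$ of order $N$ acting on $Y$, and $f(q)\in\mathbb Z[q]$, the triple $(Y,\langle g\rangle,f(q))$ exhibits the cyclic sieving phenomenon if, for $\omega$ a primitive $N$th root of unity, $|\{x\in Y\mid g^d\cdot x=x\}|=f(\omega^d)$ for all $d\ge 0$. A partition $\lambda=(\lambda_1\ge\lambda_2\ge\cdots)$ has length $\ell(\lambda)$ (number of nonzero parts) and size $|\lambda|=\sum\lambda_i$. Write $\mu\subseteq\lambda$ if $\mu_i\le\lambda_i$ for all $i$ ($\mu=\emptyset$ allowed); $\lambda/\mu$ is the skew shape obtained by removing the boxes of the Young diagram of $\mu$ from that of $\lambda$ (English convention, left-justified rows), and $|\lambda/\mu|=|\lambda|-|\mu|$. Alphabet: $\mathcal M=\{1<2<\cdots<m<\overline m<\cdots<\overline 2<\overline 1\}$. A filling of a skew shape with letters of $\mathcal M$ is semistandard if entries weakly increase along rows from left to right and strictly increase down columns. Admissible columns and splitting: a column $C$ is a strictly increasing (top to bottom) sequence of letters of $\mathcal M$. Let $z_1>\cdots>z_r$ be the unbarred letters $z$ such that both $z$ and $\overline z$ occur in $C$. $C$ is admissible if there exist unbarred letters $t_1>\cdots>t_r$ in $\{1,\ldots,m\}$ such that $t_1$ is the greatest unbarred letter with $t_1<z_1$ and $t_1,\overline{t_1}\notin C$, and for $i=2,\ldots,r$, $t_i$ is the greatest unbarred letter with $t_i<\min(t_{i-1},z_i)$ and $t_i,\overline{t_i}\notin C$. In that case $rC$ is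 the column obtained from $C$ by replacing each $\overline{z_i}$ by $\overline{t_i}$ and reordering increasingly, and $\ell C$ is the column obtained from $C$ by replacing each $z_i$ by $t_i$ and reordering increasingly. A Kashiwara–Nakashima (KN) skew symplectic tableau of shape $\lambda/\mu$ is a semistandard filling $T$ of $\lambda/\mu$ with letters of $\mathcal M$, all of whose columns are admissible, such that the split form (the filling with twice as many columns obtained by replacing each column $C$ of $T$ by the two adjacent columns $\ell C, rC$, placed in the same rows) is again semistandard. $SP(\lambda/\mu,2m)$ denotes the set of these tableaux. For $T\in SP(\lambda/\mu,2m)$, let $a_i$ (resp. $a_{\overline i}$) be the number of entries of $T$ equal to $i$ (resp. $\overline i$). Then $\mathrm{wt}(T)=(\chi_1,\ldots,\chi_m)$ with $\chi_i=a_i-a_{\overline i}$, and $\mathrm{pwr}(T)=\sum_{i=1}^m\big((i-1)a_i+(2m-i)a_{\overline i}\big)$. *)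

theory Defs
  imports
    "HOL-Algebra.Group_Action"
    "HOL-Algebra.Generated_Groups"
    "HOL-Computational_Algebra.Polynomial"
    "HOL-Computational_Algebra.Primes"
    "HOL-Library.FuncSet"
    Complex_Main
begin

section \<open>Cyclic sieving\<close>

definition primitive_root_of_unity :: "nat \<Rightarrow> complex \<Rightarrow> bool" where
  "primitive_root_of_unity N \<omega> \<longleftrightarrow>
     N > 0 \<and> \<omega> ^ N = 1 \<and> (\<forall>k. 0 < k \<and> k < N \<longrightarrow> \<omega> ^ k \<noteq> 1)"

text \<open>The set \<open>invariants Y \<phi> h\<close> consists of the points of \<open>Y\<close> fixed by \<open>h\<close>.  Since \<open>f\<close> has
  integer coefficients, it does not matter whether one or every primitive root is used.\<close>

definition cyclic_sieving ::
    "'a set \<Rightarrow> ('g, 'b) monoid_scheme \<Rightarrow> 'g \<Rightarrow> ('g \<Rightarrow> 'a \<Rightarrow> 'a) \<Rightarrow> int poly \<Rightarrow> bool" where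
  "cyclic_sieving Y G g \<phi> f \<longleftrightarrow>
     finite Y \<and> finite (carrier G) \<and> g \<in> carrier G \<and> generate G {g} = carrier G \<and>
     group_action G Y \<phi> \<and>
     (\<forall>\<omega>. primitive_root_of_unity (card (carrier G)) \<omega> \<longrightarrow>
        (\<forall>d::nat. of_nat (card (invariants Y \<phi> (g [^]\<^bsub>G\<^esub> d))) =
                   poly (map_poly of_int f) (\<omega> ^ d)))"


section \<open>Partitions and skew shapes\<close>

text \<open>Rows and columns are numbered from 0, so \<open>\<lambda> i\<close> is the part usually written
  \<open>\<lambda>\<^sub>i\<^sub>+\<^sub>1\<close>.\<close>

definition is_partition :: "(nat \<Rightarrow> nat) \<Rightarrow> bool" where
  "is_partition lam \<longleftrightarrow> antimono lam \<and> finite {i. lam i \<noteq> 0}"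

definition partition_length :: "(nat \<Rightarrow> nat) \<Rightarrow> nat" where
  "partition_length lam = card {i. lam i \<noteq> 0}"

definition partition_size :: "(nat \<Rightarrow> nat) \<Rightarrow> nat" where
  "partition_size lam = (\<Sum>i | lam i \<noteq> 0. lam i)"

definition skew_shape :: "(nat \<Rightarrow> nat) \<Rightarrow> (nat \<Rightarrow> nat) \<Rightarrow> (nat \<times> nat) set" where
  "skew_shape lam mu = {(i, j). mu i \<le> j \<and> j < lam i}"


section \<open>The symplectic alphabet\<close>

datatype letter = Unbarred nat | Barred nat

instantiation letter :: linorder
begin

fun less_eq_letter :: "letter \<Rightarrow> letter \<Rightarrow> bool" where
  "Unbarred i \<le> Unbarred j \<longleftrightarrow> i \<le> j"
| "Unbarred i \<le> Barred j \<longleftrightarrow> True"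
| "Barred i \<le> Unbarred j \<longleftrightarrow> False"
| "Barred i \<le> Barred j \<longleftrightarrow> j \<le> i"

definition less_letter :: "letter \<Rightarrow> letter \<Rightarrow> bool" where
  "x < y \<longleftrightarrow> x \<le> y \<and> \<not> y \<le> (x::letter)"

instance
proof
  fix x y z :: letter
  show "x < y \<longleftrightarrow> x \<le> y \<and> \<not> y \<le> x" by (rule less_letter_def)
  show "x \<le> x" by (cases x) auto
  show "x \<le> z" if "x \<le> y" "y \<le> z" using that by (cases x; cases y; cases z) auto
  show "x = y" if "x \<le> y" "y \<le> x" using that by (cases x; cases y) auto
  show "x \<le> y \<or> y \<le> x" by (cases x; cases y) auto
qed

end

definition alphabet :: "nat \<Rightarrow> letter set" where
  "alphabet m = Unbarred ` {1..m} \<union> Barred ` {1..m}"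


section \<open>Admissible columns and their splitting\<close>

text \<open>Columns are lists read from top to bottom; \<open>double_letters C\<close> is \<open>[z\<^sub>1, \<dots>, z\<^sub>r]\<close> with
  \<open>z\<^sub>1 > \<dots> > z\<^sub>r\<close>.\<close>

definition double_letters :: "letter list \<Rightarrow> nat list" where
  "double_letters C = rev (sorted_list_of_set {z. Unbarred z \<in> set C \<and> Barred z \<in> set C})"

definition split_candidates :: "nat \<Rightarrow> letter list \<Rightarrow> nat list \<Rightarrow> nat \<Rightarrow> nat set" where
  "split_candidates m C ts i =
     {t \<in> {1..m}. t < double_letters C ! i \<and> (i > 0 \<longrightarrow> t < ts ! (i - 1)) \<and>
                  Unbarred t \<notin> set C \<and> Barred t \<notin> set C}"

definition split_letters :: "nat \<Rightarrow> letter list \<Rightarrow> nat list \<Rightarrow> bool" where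
  "split_letters m C ts \<longleftrightarrow>
     length ts = length (double_letters C) \<and>
     (\<forall>i < length ts. ts ! i \<in> split_candidates m C ts i \<and>
                      (\<forall>t \<in> split_candidates m C ts i. t \<le> ts ! i))"

definition admissible :: "nat \<Rightarrow> letter list \<Rightarrow> bool" where
  "admissible m C \<longleftrightarrow>
     sorted_wrt (<) C \<and> set C \<subseteq> alphabet m \<and> (\<exists>ts. split_letters m C ts)"

definition split_map :: "nat \<Rightarrow> letter list \<Rightarrow> nat \<Rightarrow> nat" where
  "split_map m C z =
     (case map_of (zip (double_letters C) (THE ts. split_letters m C ts)) z of
        Some t \<Rightarrow> t | None \<Rightarrow> z)"

text \<open>The list of letters \<open>t\<^sub>1, \<dots>, t\<^sub>r\<close> is unique if it exists, so \<open>split_map m C\<close> sends each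
  \<open>z\<^sub>i\<close> to \<open>t\<^sub>i\<close> and fixes everything else when \<open>C\<close> is admissible; the following two columns
  are meaningful only in that case.\<close>

definition left_column :: "nat \<Rightarrow> letter list \<Rightarrow> letter list" where
  "left_column m C =
     sort (map (\<lambda>x. case x of Unbarred z \<Rightarrow> Unbarred (split_map m C z) | Barred z \<Rightarrow> Barred z) C)"

definition right_column :: "nat \<Rightarrow> letter list \<Rightarrow> letter list" where
  "right_column m C =
     sort (map (\<lambda>x. case x of Unbarred z \<Rightarrow> Unbarred z | Barred z \<Rightarrow> Barred (split_map m C z)) C)"


section \<open>Kashiwara--Nakashima skew symplectic tableaux\<close>

type_synonym filling = "nat \<times> nat \<Rightarrow> letter"

definition semistandard :: "(nat \<times> nat) set \<Rightarrow> filling \<Rightarrow> bool" where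
  "semistandard S T \<longleftrightarrow>
     (\<forall>i j j'. (i, j) \<in> S \<and> (i, j') \<in> S \<and> j < j' \<longrightarrow> T (i, j) \<le> T (i, j')) \<and>
     (\<forall>i i' j. (i, j) \<in> S \<and> (i', j) \<in> S \<and> i < i' \<longrightarrow> T (i, j) < T (i', j))"

definition column :: "(nat \<times> nat) set \<Rightarrow> filling \<Rightarrow> nat \<Rightarrow> letter list" where
  "column S T j = map (\<lambda>i. T (i, j)) (sorted_list_of_set {i. (i, j) \<in> S})"

text \<open>Columns \<open>2j\<close> and \<open>2j + 1\<close> of the split form are the left and the right column obtained from
  column \<open>j\<close>.  The box in row \<open>i\<close> holds the entry whose position is the number of boxes
  above it in its column.  The split form lives on the skew shape \<open>2\<lambda>/2\<mu>\<close>.\<close>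

definition split_form :: "nat \<Rightarrow> (nat \<times> nat) set \<Rightarrow> filling \<Rightarrow> filling" where
  "split_form m S T =
     (\<lambda>(i, j). (if even j then left_column m (column S T (j div 2))
                          else right_column m (column S T (j div 2)))
               ! card {i'. i' < i \<and> (i', j div 2) \<in> S})"

text \<open>Fillings are extensional functions, undefined outside the shape, so that distinct
  elements of \<open>SP\<close> are distinct tableaux.\<close>

definition SP :: "nat \<Rightarrow> (nat \<Rightarrow> nat) \<Rightarrow> (nat \<Rightarrow> nat) \<Rightarrow> filling set" where
  "SP m lam mu =
     {T \<in> skew_shape lam mu \<rightarrow>\<^sub>E alphabet m.
        semistandard (skew_shape lam mu) T \<and>
        (\<forall>j. admissible m (column (skew_shape lam mu) T j)) \<and>
        semistandard (skew_shape (\<lambda>i. 2 * lam i) (\<lambda>i. 2 * mu i))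
                     (split_form m (skew_shape lam mu) T)}"

definition letter_count :: "(nat \<times> nat) set \<Rightarrow> filling \<Rightarrow> letter \<Rightarrow> nat" where
  "letter_count S T x = card {b \<in> S. T b = x}"

definition wt :: "nat \<Rightarrow> (nat \<times> nat) set \<Rightarrow> filling \<Rightarrow> int list" where
  "wt m S T =
     map (\<lambda>i. int (letter_count S T (Unbarred i)) - int (letter_count S T (Barred i))) [1..<m+1]"

definition pwr :: "nat \<Rightarrow> (nat \<times> nat) set \<Rightarrow> filling \<Rightarrow> nat" where
  "pwr m S T =
     (\<Sum>i = 1..m. (i - 1) * letter_count S T (Unbarred i)
                   + (2 * m - i) * letter_count S T (Barred i))"

definition pwr_polynomial :: "nat \<Rightarrow> (nat \<Rightarrow> nat) \<Rightarrow> (nat \<Rightarrow> nat) \<Rightarrow> int poly" where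
  "pwr_polynomial m lam mu =
     (\<Sum>T \<in> SP m lam mu. monom 1 (pwr m (skew_shape lam mu) T))"

end

theory Submission
  imports Defs "HOL-Algebra.Multiplicative_Group"
begin

text \<open>Write \<open>N w\<close> for the number of tableaux of weight \<open>w\<close>.  If \<open>2 * m\<close> divides \<open>d\<close>, then \<open>g\<close> to
the power \<open>d\<close> is the identity and both sides count all tableaux.  Otherwise both sides are zero, and
the reason is the same arithmetic fact in both cases: an odd prime dividing \<open>m\<close> exceeds \<open>n\<close>, so
\<open>2 * m\<close> is coprime to every odd number up to \<open>n\<close> (\<open>coprime_2m_odd\<close>).

\<^item> Fixed points.  Place the coordinates of a weight on a cycle of length \<open>2 * m\<close>, positive ones in
  the first half and negative ones in the second half.  The signed shift advances everything by one
  step, so the sum of the positions, weighted by absolute values, grows modulo \<open>2 * m\<close> by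
  \<open>L\<close>, the sum of the absolute values.  A weight fixed by \<open>d\<close> shifts forces \<open>2 * m\<close> to divide
  \<open>d * L\<close> (\<open>shift_funpow_fixed\<close>); as \<open>L\<close> is odd and at most \<open>n\<close>, this is impossible.

\<^item> The polynomial.  Let \<open>\<zeta> = \<omega> ^ d\<close> and choose \<open>\<eta>\<close> with \<open>\<eta> ^ 2 = \<zeta>\<close>.  Up to the factor
  \<open>\<eta> ^ n\<close>, the value at \<open>\<zeta>\<close> is the sum of \<open>N w\<close> times the monomial of exponent \<open>w\<close> in the
  points \<open>\<eta>, \<eta> ^ 3, \<dots>, \<eta> ^ (2 * m - 1)\<close> (\<open>power_pwr\<close>).  These points and their inverses
  together are permuted by multiplication with \<open>\<zeta>\<close>, so the power sum of degree \<open>k\<close> vanishes unless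
  \<open>\<zeta> ^ k = 1\<close>, which the arithmetic fact excludes for odd \<open>k\<close> up to \<open>n\<close>.  If \<open>N\<close> is invariant under all signed permutations of the coordinates, then averaging the
  monomials over signed permutations and expanding in power sums leaves in every term a power sum of
  odd degree, and the total is zero (\<open>sum_signed_permutation_invariant_eq_0\<close>).\<close>

text \<open>It remains to see that \<open>N\<close> is invariant under signed permutations.  The action of \<open>g\<close> gives
invariance under the signed shift, and together with the exchange of the last two coordinates the
signed shift generates all signed permutations (\<open>shift_swap_imp_signed_permutation_invariant\<close>).
The exchange (\<open>card_SP_swap\<close>) comes from the crystal operators that turn \<open>m - 1\<close> into \<open>m\<close>
and \<open>m\<close> barred into \<open>m - 1\<close> barred: they cut the set of tableaux into strings, and reversing each
string exchanges the two coordinates.  The point is that these operators do not leave the set of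
tableaux.  Two facts reduce this to a finite check.

\<^item> A tableau is a list of column sets in which only adjacent columns constrain each other, and the
  constraint compares, for every threshold, the number of smaller letters in the right column \<open>rC\<close> of
  one with that in the left column \<open>lD\<close> of the next (\<open>SP_iff\<close>).  The tensor product rule tells which
  column an operator changes, and it implies an inequality between that column and each of its
  neighbours; so it suffices to treat pairs of columns (\<open>list_F_chains\<close>, \<open>list_E_chains\<close>).

\<^item> The four letters concerned are adjacent in the alphabet, and the greedy choice of the letters
  \<open>t\<^sub>i\<close> starts with them.  Hence the operators change \<open>rC\<close> and \<open>lC\<close> only inside these four
  letters (\<open>greedy_core\<close>), the comparison of two columns changes at three thresholds only, and what is
  left is a statement about two patterns of four truth values (\<open>bits_F_left\<close> and its companions).\<close>

section \<open>Symmetric sums of odd degree\<close>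

definition sym_power :: "complex \<Rightarrow> int \<Rightarrow> complex" where
  "sym_power y k = y powi k + y powi (- k)"

text \<open>Blocks arise when several coordinates are evaluated at the same point: the product of their
symmetric powers is the function attached to the merged block.\<close>

definition block :: "int list \<Rightarrow> complex \<Rightarrow> complex" where
  "block S y = (\<Prod>k\<leftarrow>S. sym_power y k)"

lemma block_simps [simp]:
  "block [] y = 1" "block (k # S) y = sym_power y k * block S y"
  "block (S @ S') y = block S y * block S' y"
  by (simp_all add: block_def)

lemma sym_power_mult:
  assumes "y \<noteq> 0"
  shows "sym_power y q * sym_power y k = sym_power y (q + k) + sym_power y (q - k)"
  using assms by (simp add: sym_power_def power_int_add power_int_diff power_int_minus field_simps)

text \<open>A product of symmetric powers is a combination of symmetric powers whose exponents are signed
sums of the original ones.  These all have the parity of the plain sum and are bounded by the sum of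
the absolute values.  The leading factor \<open>sym_power (x j) q\<close> is the part already expanded.\<close>

lemma sum_block_eq_0:
  fixes x :: "nat \<Rightarrow> complex" and n :: nat
  assumes nz: "\<And>j. j \<in> J \<Longrightarrow> x j \<noteq> 0"
    and vanish: "\<And>k. odd k \<Longrightarrow> \<bar>k\<bar> \<le> int n \<Longrightarrow> (\<Sum>j\<in>J. sym_power (x j) k) = 0"
  shows "odd (q + sum_list S) \<Longrightarrow> \<bar>q\<bar> + (\<Sum>k\<leftarrow>S. \<bar>k\<bar>) \<le> int n
    \<Longrightarrow> (\<Sum>j\<in>J. sym_power (x j) q * block S (x j)) = 0"
proof (induction S arbitrary: q)
  case Nil
  then show ?case using vanish[of q] by simp
next
  case (Cons k S)
  have "(\<Sum>j\<in>J. sym_power (x j) q * block (k # S) (x j))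
      = (\<Sum>j\<in>J. sym_power (x j) (q + k) * block S (x j) + sym_power (x j) (q - k) * block S (x j))"
  proof (rule sum.cong)
    fix j assume "j \<in> J"
    then have "x j \<noteq> 0" by (rule nz)
    have "sym_power (x j) q * block (k # S) (x j)
        = (sym_power (x j) q * sym_power (x j) k) * block S (x j)" by simp
    also have "\<dots> = sym_power (x j) (q + k) * block S (x j) + sym_power (x j) (q - k) * block S (x j)"
      by (simp only: sym_power_mult[OF \<open>x j \<noteq> 0\<close>] distrib_right)
    finally show "sym_power (x j) q * block (k # S) (x j)
        = sym_power (x j) (q + k) * block S (x j) + sym_power (x j) (q - k) * block S (x j)" .
  qed simp
  also have "\<dots> = 0"
  proof -
    have "odd (q + k + sum_list S)" "odd (q - k + sum_list S)"
      using Cons.prems(1) by (simp_all add: algebra_simps)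
    moreover have "\<bar>q + k\<bar> + (\<Sum>k\<leftarrow>S. \<bar>k\<bar>) \<le> int n" "\<bar>q - k\<bar> + (\<Sum>k\<leftarrow>S. \<bar>k\<bar>) \<le> int n"
      using Cons.prems(2) by auto
    ultimately show ?thesis by (simp add: sum.distrib Cons.IH)
  qed
  finally show ?case .
qed

definition injective_words :: "'a set \<Rightarrow> nat \<Rightarrow> 'a list set" where
  "injective_words J l = {xs. distinct xs \<and> set xs \<subseteq> J \<and> length xs = l}"

lemma finite_injective_words: "finite J \<Longrightarrow> finite (injective_words J l)"
  by (rule finite_subset[OF _ finite_lists_length_eq[of J l]]) (auto simp: injective_words_def)

lemma sum_injective_words_Suc:
  fixes f :: "'a list \<Rightarrow> complex"
  assumes "finite J"
  shows "(\<Sum>xs\<in>injective_words J (Suc l). f xs)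
       = (\<Sum>ys\<in>injective_words J l. \<Sum>j\<in>J - set ys. f (j # ys))"
proof -
  have "(\<Sum>ys\<in>injective_words J l. \<Sum>j\<in>J - set ys. f (j # ys))
      = (\<Sum>(ys, j)\<in>(SIGMA ys:injective_words J l. J - set ys). f (j # ys))"
    using assms by (simp add: sum.Sigma finite_injective_words)
  also have "\<dots> = (\<Sum>xs\<in>injective_words J (Suc l). f xs)"
    by (rule sum.reindex_bij_witness[where i = "\<lambda>xs. (tl xs, hd xs)" and j = "\<lambda>(ys, j). j # ys"])
       (auto simp: injective_words_def length_Suc_conv)
  finally show ?thesis by simp
qed

definition injective_sum :: "nat set \<Rightarrow> (nat \<Rightarrow> complex) \<Rightarrow> int list list \<Rightarrow> complex" where
  "injective_sum J x Ss =
     (\<Sum>xs\<in>injective_words J (length Ss). \<Prod>s<length Ss. block (Ss ! s) (x (xs ! s)))"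

text \<open>Inclusion and exclusion for the first block: sum over all points, then subtract the cases where
its point coincides with that of a later block, which amounts to merging the two blocks.\<close>

lemma injective_sum_Cons:
  assumes J: "finite J"
  shows "injective_sum J x (S # Ss) =
    (\<Sum>j\<in>J. block S (x j)) * injective_sum J x Ss
      - (\<Sum>s<length Ss. injective_sum J x (Ss[s := S @ Ss ! s]))"
proof -
  let ?l = "length Ss"
  let ?P = "\<lambda>ys. \<Prod>s<?l. block (Ss ! s) (x (ys ! s))"
  have merge: "block S (x (ys ! s)) * ?P ys
      = (\<Prod>s'<?l. block (Ss[s := S @ Ss ! s] ! s') (x (ys ! s')))" if "s < ?l" for ys s
  proof -
    have "(\<Prod>s'<?l. block (Ss[s := S @ Ss ! s] ! s') (x (ys ! s')))
       = block (S @ Ss ! s) (x (ys ! s)) * (\<Prod>s'\<in>{..<?l} - {s}. block (Ss[s := S @ Ss ! s] ! s') (x (ys ! s')))"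
      using that by (subst prod.remove[of _ s]) auto
    also have "(\<Prod>s'\<in>{..<?l} - {s}. block (Ss[s := S @ Ss ! s] ! s') (x (ys ! s')))
       = (\<Prod>s'\<in>{..<?l} - {s}. block (Ss ! s') (x (ys ! s')))"
      by (rule prod.cong) auto
    also have "block (S @ Ss ! s) (x (ys ! s)) * \<dots> = block S (x (ys ! s)) * ?P ys"
      using that by (subst (2) prod.remove[of _ s]) auto
    finally show ?thesis by simp
  qed
  have "injective_sum J x (S # Ss)
      = (\<Sum>ys\<in>injective_words J ?l. \<Sum>j\<in>J - set ys. block S (x j) * ?P ys)"
    unfolding injective_sum_def
    by (simp add: sum_injective_words_Suc[OF J] prod.lessThan_Suc_shift del: prod.lessThan_Suc)
  also have "\<dots> = (\<Sum>ys\<in>injective_words J ?l.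
      (\<Sum>j\<in>J. block S (x j)) * ?P ys - (\<Sum>s<?l. block S (x (ys ! s)) * ?P ys))"
  proof (rule sum.cong)
    fix ys assume "ys \<in> injective_words J ?l"
    then have ys: "distinct ys" "set ys \<subseteq> J" "length ys = ?l" by (auto simp: injective_words_def)
    have "(\<Sum>j\<in>set ys. block S (x j)) = (\<Sum>s<?l. block S (x (ys ! s)))"
      using sum.reindex_bij_betw[OF bij_betw_nth[OF ys(1), of "{..<?l}" "set ys"], of "\<lambda>j. block S (x j)"] ys
      by simp
    moreover have "(\<Sum>j\<in>J - set ys. block S (x j)) = (\<Sum>j\<in>J. block S (x j)) - (\<Sum>j\<in>set ys. block S (x j))"
      using J ys by (simp add: sum_diff)
    ultimately show "(\<Sum>j\<in>J - set ys. block S (x j) * ?P ys)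
        = (\<Sum>j\<in>J. block S (x j)) * ?P ys - (\<Sum>s<?l. block S (x (ys ! s)) * ?P ys)"
      by (simp add: sum_distrib_right[symmetric] left_diff_distrib)
  qed simp
  also have "\<dots> = (\<Sum>j\<in>J. block S (x j)) * injective_sum J x Ss
      - (\<Sum>ys\<in>injective_words J ?l. \<Sum>s<?l. block S (x (ys ! s)) * ?P ys)"
    by (simp add: sum_subtractf injective_sum_def sum_distrib_left)
  also have "(\<Sum>ys\<in>injective_words J ?l. \<Sum>s<?l. block S (x (ys ! s)) * ?P ys)
      = (\<Sum>s<?l. injective_sum J x (Ss[s := S @ Ss ! s]))"
    by (subst sum.swap) (simp add: injective_sum_def merge)
  finally show ?thesis .
qed

lemma sum_list_update_append:
  fixes S :: "'b list" and h :: "'b list \<Rightarrow> int"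
  assumes "\<And>A B. h (A @ B) = h A + h B" and "s < length Ss"
  shows "(\<Sum>S'\<leftarrow>Ss[s := S @ Ss ! s]. h S') = h S + (\<Sum>S'\<leftarrow>Ss. h S')"
  using assms(2)
proof (induction Ss arbitrary: s)
  case (Cons A Ss)
  then show ?case by (cases s) (auto simp: assms(1))
qed simp

text \<open>If the first block has odd sum, then its unrestricted sum vanishes; otherwise the remaining blocks
have odd total.  Merging preserves the total, so induction on the number of blocks applies.\<close>

lemma injective_sum_eq_0:
  fixes x :: "nat \<Rightarrow> complex" and n :: nat
  assumes J: "finite J" and nz: "\<And>j. j \<in> J \<Longrightarrow> x j \<noteq> 0"
    and vanish: "\<And>k. odd k \<Longrightarrow> \<bar>k\<bar> \<le> int n \<Longrightarrow> (\<Sum>j\<in>J. sym_power (x j) k) = 0"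
  shows "odd (\<Sum>S\<leftarrow>Ss. sum_list S) \<Longrightarrow> (\<Sum>S\<leftarrow>Ss. \<Sum>k\<leftarrow>S. \<bar>k\<bar>) \<le> int n \<Longrightarrow> injective_sum J x Ss = 0"
proof (induction "length Ss" arbitrary: Ss)
  case 0
  then show ?case by simp
next
  case (Suc l)
  then obtain S Ss' where Ss: "Ss = S # Ss'" and l: "l = length Ss'" by (cases Ss) auto
  have abs_nonneg: "(\<Sum>k\<leftarrow>S. \<bar>k\<bar>) \<ge> 0" "(\<Sum>S\<leftarrow>Ss'. \<Sum>k\<leftarrow>S. \<bar>k\<bar>) \<ge> 0"
    by (auto intro!: sum_list_nonneg)
  have "injective_sum J x (Ss'[s := S @ Ss' ! s]) = 0" if "s < length Ss'" for s
  proof (rule Suc.hyps(1))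
    show "l = length (Ss'[s := S @ Ss' ! s])" using l by simp
    show "odd (\<Sum>S\<leftarrow>Ss'[s := S @ Ss' ! s]. sum_list S)"
      using Suc.prems(1) that by (subst sum_list_update_append) (auto simp: Ss)
    show "(\<Sum>S\<leftarrow>Ss'[s := S @ Ss' ! s]. \<Sum>k\<leftarrow>S. \<bar>k\<bar>) \<le> int n"
      using Suc.prems(2) that by (subst sum_list_update_append) (auto simp: Ss)
  qed
  moreover have "(\<Sum>j\<in>J. block S (x j)) * injective_sum J x Ss' = 0"
  proof (cases "odd (sum_list S)")
    case True
    have "(\<Sum>j\<in>J. sym_power (x j) 0 * block S (x j)) = 0"
      using sum_block_eq_0[of J x n 0 S, OF nz vanish] True Suc.prems(2) abs_nonneg by (simp add: Ss)
    then have "(\<Sum>j\<in>J. block S (x j)) = 0"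
      by (simp add: sym_power_def sum_distrib_left[symmetric])
    then show ?thesis by simp
  next
    case False
    then have "injective_sum J x Ss' = 0"
      using Suc.prems abs_nonneg by (intro Suc.hyps(1) l) (auto simp: Ss)
    then show ?thesis by simp
  qed
  ultimately show ?case by (simp add: Ss injective_sum_Cons[OF J])
qed

lemma sum_odd_powers:
  fixes y :: complex
  assumes "y \<noteq> 0"
  shows "(y ^ 2 - 1) * (\<Sum>j<m. y ^ (2 * j + 1) + inverse y ^ (2 * j + 1)) = y * (y ^ (2 * m) - inverse y ^ (2 * m))"
proof (induction m)
  case (Suc m)
  have "(y ^ 2 - 1) * (\<Sum>j<Suc m. y ^ (2 * j + 1) + inverse y ^ (2 * j + 1)) 
     = y * (y ^ (2 * m) - inverse y ^ (2 * m)) + (y ^ 2 - 1) * (y ^ (2 * m + 1) + inverse y ^ (2 * m + 1))"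
    by (simp only: sum.lessThan_Suc distrib_left Suc)
  also have "\<dots> = y * (y ^ (2 * Suc m) - inverse y ^ (2 * Suc m))"
    using assms by (simp add: field_simps power2_eq_square)
  finally show ?case .
qed simp

text \<open>The exponents \<open>2 * j + 1\<close> and their negatives run, modulo \<open>4 * m\<close>, through all odd residues, so
this is a geometric sum with ratio \<open>(\<eta> ^ 2) powi k\<close> over a full period.\<close>

lemma sum_sym_power_eq_0:
  fixes \<eta> :: complex
  assumes "\<eta> ^ (4 * m) = 1" and "m > 0" and "(\<eta> ^ 2) powi k \<noteq> 1"
  shows "(\<Sum>j<m. sym_power (\<eta> ^ (2 * j + 1)) k) = 0"
proof -
  have "\<eta> \<noteq> 0" using assms(1,2) by (metis mult_pos_pos power_0_left zero_less_numeral zero_neq_one less_numeral_extra(3))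
  define y where "y = \<eta> powi k"
  have y0: "y \<noteq> 0" using \<open>\<eta> \<noteq> 0\<close> by (simp add: y_def)
  have y4: "y ^ (4 * m) = 1"
  proof -
    have "y ^ (4 * m) = (\<eta> ^ (4 * m)) powi k"
      by (simp add: y_def power_int_power power_int_power' mult.commute)
    then show ?thesis using assms(1) by simp
  qed
  have "y ^ 2 = (\<eta> ^ 2) powi k"
    by (simp add: y_def power_int_power power_int_power' mult.commute)
  then have y2: "y ^ 2 \<noteq> 1" using assms(3) by simp
  have t: "sym_power (\<eta> ^ (2 * j + 1)) k = y ^ (2 * j + 1) + inverse y ^ (2 * j + 1)" for j
  proof -
    have "(\<eta> ^ (2 * j + 1)) powi k = y ^ (2 * j + 1)"
      unfolding y_def power_int_power power_int_power' by (simp add: mult.commute)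
    then show ?thesis unfolding sym_power_def power_int_minus by (simp add: power_inverse)
  qed
  have "y ^ (2 * m) * y ^ (2 * m) = 1" using y4 by (simp flip: power_add)
  then have "y ^ (2 * m) - inverse y ^ (2 * m) = 0"
    by (metis inverse_unique power_inverse right_minus_eq)
  then have "(y ^ 2 - 1) * (\<Sum>j<m. y ^ (2 * j + 1) + inverse y ^ (2 * j + 1)) = 0"
    using sum_odd_powers[OF y0, of m] by simp
  then show ?thesis unfolding t using y2 by (simp del: power_Suc)
qed

section \<open>Signed permutations of weights\<close>

definition shift_weight :: "int list \<Rightarrow> int list" where
  "shift_weight w = (- last w) # butlast w"

lemma length_shift_weight: "w \<noteq> [] \<Longrightarrow> length (shift_weight w) = length w"
  by (simp add: shift_weight_def)

text \<open>Conjugating the exchange of the last two coordinates by shifts gives all adjacent exchanges, hence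
all permutations; a single shift followed by a permutation changes one sign.\<close>

lemma shift_swap_imp_signed_permutation_invariant:
  fixes N :: "int list \<Rightarrow> 'a"
  assumes shift: "\<And>w. length w = m \<Longrightarrow> w \<noteq> [] \<Longrightarrow> N (shift_weight w) = N w"
    and swap: "\<And>u x y. length u + 2 = m \<Longrightarrow> N (u @ [x, y]) = N (u @ [y, x])"
    and w: "length w = m" and w': "mset (map abs w) = mset (map abs w')"
  shows "N w = N w'"
proof -
  \<comment> \<open>The last \<open>length v\<close> coordinates are shifted to the front.\<close>
  have rotate: "length (u @ v) = m \<Longrightarrow> N (u @ v) = N (map uminus v @ u)" for u v
  proof (induction v arbitrary: u rule: rev_induct)
    case (snoc x v)
    have "N (u @ v @ [x]) = N ((- x # u) @ v)"
      using shift[of "u @ v @ [x]"] snoc.prems by (simp add: shift_weight_def butlast_append)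
    also have "\<dots> = N (map uminus v @ (- x # u))"
      using snoc.prems by (intro snoc.IH) simp
    finally show ?case by simp
  qed simp
  have adjacent: "N (u @ x # y # v) = N (u @ y # x # v)" if "length u + length v + 2 = m" for u v x y
  proof -
    have "N (u @ x # y # v) = N ((map uminus v @ u) @ [x, y])"
      using rotate[of "u @ [x, y]" v] that by simp
    also have "\<dots> = N ((map uminus v @ u) @ [y, x])"
      using that by (intro swap) simp
    also have "\<dots> = N (u @ y # x # v)"
      using rotate[of "u @ [y, x]" v] that by simp
    finally show ?thesis .
  qed
  have move: "length ws + length u + length v + 1 = m \<Longrightarrow> N (ws @ u @ x # v) = N (ws @ x # u @ v)"
    for ws u v x
  proof (induction u arbitrary: ws)
    case (Cons y u)
    have "N (ws @ (y # u) @ x # v) = N ((ws @ [y]) @ x # u @ v)"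
      using Cons.IH[of "ws @ [y]"] Cons.prems by simp
    also have "\<dots> = N (ws @ x # (y # u) @ v)"
      using adjacent[of ws "u @ v" y x] Cons.prems by simp
    finally show ?case .
  qed simp
  have perm: "length ws + length u = m \<Longrightarrow> mset u = mset v \<Longrightarrow> N (ws @ u) = N (ws @ v)" for ws u v
  proof (induction u arbitrary: ws v)
    case (Cons x u)
    have "x \<in> set v" using Cons.prems(2) by (metis list.set_intros(1) set_mset_mset)
    then obtain v1 v2 where v: "v = v1 @ x # v2" by (auto simp: in_set_conv_decomp)
    have mset: "mset u = mset (v1 @ v2)" using Cons.prems(2) v by simp
    then have len: "length u = length v1 + length v2" by (metis size_mset length_append)
    have "N (ws @ x # u) = N ((ws @ [x]) @ v1 @ v2)"
      using Cons.IH[of "ws @ [x]" "v1 @ v2"] mset Cons.prems(1) by simp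
    also have "\<dots> = N (ws @ v)"
      using move[of ws v1 v2 x] Cons.prems(1) len v by simp
    finally show ?case .
  qed simp
  \<comment> \<open>Move \<open>x\<close> to the end, shift it to the front with opposite sign, and move it back.\<close>
  have sign: "N (u @ x # v) = N (u @ (- x) # v)" if "length u + length v + 1 = m" for u v x
  proof -
    have "N (u @ x # v) = N (u @ v @ [x])"
      using perm[of "[]" "u @ x # v" "u @ v @ [x]"] that by simp
    also have "\<dots> = N ((- x) # u @ v)"
      using shift[of "u @ v @ [x]"] that by (simp add: shift_weight_def butlast_append)
    also have "\<dots> = N (u @ (- x) # v)"
      using perm[of "[]" "(- x) # u @ v" "u @ (- x) # v"] that by simp
    finally show ?thesis .
  qed
  have abs: "length u + length v = m \<Longrightarrow> N (u @ v) = N (u @ map abs v)" for u v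
  proof (induction v arbitrary: u)
    case (Cons x v)
    have "N (u @ x # v) = N (u @ \<bar>x\<bar> # v)"
      using sign[of u v x] Cons.prems by (cases "x \<ge> 0") auto
    then show ?case using Cons.IH[of "u @ [\<bar>x\<bar>]"] Cons.prems by simp
  qed simp
  have "length w' = m" using w w' by (metis size_mset length_map)
  then show ?thesis
    using abs[of "[]" w] abs[of "[]" w'] perm[of "[]" "map abs w" "map abs w'"] w w' by simp
qed

text \<open>Position of a coordinate on the cycle \<open>1, \<dots>, m\<close>, followed by \<open>1, \<dots>, m\<close> barred, counted
from 0.\<close>

definition position_sum :: "int list \<Rightarrow> int" where
  "position_sum w = (\<Sum>i<length w. \<bar>w ! i\<bar> * int (if w ! i < 0 then i + length w else i))"

text \<open>Every coordinate moves one step along the cycle; the last one passes from \<open>m\<close> to \<open>1\<close> barred,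
or, when negative, from \<open>m\<close> barred back to \<open>1\<close>, where \<open>2 * m\<close> is lost.\<close>

lemma position_sum_shift:
  assumes "w \<noteq> []"
  shows "2 * int (length w) dvd position_sum (shift_weight w) - (position_sum w + (\<Sum>x\<leftarrow>w. \<bar>x\<bar>))"
proof -
  obtain u x where w: "w = u @ [x]" using assms by (cases w rule: rev_cases) auto
  let ?m = "Suc (length u)"
  let ?p = "\<lambda>i. if u ! i < 0 then i + ?m else i"
  have 1: "position_sum w = (\<Sum>i<length u. \<bar>u ! i\<bar> * int (?p i))
      + \<bar>x\<bar> * int (if x < 0 then length u + ?m else length u)"
    unfolding position_sum_def w by (simp add: nth_append) (intro sum.cong, auto)
  have 2: "position_sum (shift_weight w) = \<bar>x\<bar> * int (if x > 0 then ?m else 0)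
      + (\<Sum>i<length u. \<bar>u ! i\<bar> * int (?p i)) + (\<Sum>i<length u. \<bar>u ! i\<bar>)"
    unfolding position_sum_def w shift_weight_def
    by (simp add: sum.lessThan_Suc_shift sum.distrib[symmetric] algebra_simps del: sum.lessThan_Suc)
       (intro sum.cong, auto simp: algebra_simps)
  have 3: "(\<Sum>x\<leftarrow>w. \<bar>x\<bar>) = (\<Sum>i<length u. \<bar>u ! i\<bar>) + \<bar>x\<bar>"
    by (simp add: w sum_list_sum_nth atLeast0LessThan nth_append)
  have "position_sum (shift_weight w) - (position_sum w + (\<Sum>x\<leftarrow>w. \<bar>x\<bar>))
      = 2 * int ?m * (if x < 0 then - \<bar>x\<bar> else 0)"
    unfolding 1 2 3 by (simp add: algebra_simps)
  then show ?thesis by (simp add: w)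
qed

lemma sum_abs_shift: "w \<noteq> [] \<Longrightarrow> (\<Sum>x\<leftarrow>shift_weight w. \<bar>x\<bar>) = (\<Sum>x\<leftarrow>w. \<bar>x\<bar>)"
  by (cases w rule: rev_cases) (auto simp: shift_weight_def)

lemma shift_funpow_fixed:
  assumes "w \<noteq> []" "(shift_weight ^^ d) w = w"
  shows "2 * int (length w) dvd int d * (\<Sum>x\<leftarrow>w. \<bar>x\<bar>)"
proof -
  let ?L = "(\<Sum>x\<leftarrow>w. \<bar>x\<bar>)"
  have "(shift_weight ^^ d) w \<noteq> [] \<and> length ((shift_weight ^^ d) w) = length w
      \<and> (\<Sum>x\<leftarrow>(shift_weight ^^ d) w. \<bar>x\<bar>) = ?L
      \<and> 2 * int (length w) dvd position_sum ((shift_weight ^^ d) w) - (position_sum w + int d * ?L)" for d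
  proof (induction d)
    case (Suc d)
    let ?v = "(shift_weight ^^ d) w"
    have "2 * int (length w) dvd (position_sum (shift_weight ?v) - (position_sum ?v + ?L))
        + (position_sum ?v - (position_sum w + int d * ?L))"
      using Suc position_sum_shift[of ?v] by (intro dvd_add) auto
    then have "2 * int (length w) dvd position_sum (shift_weight ?v) - (position_sum w + int (Suc d) * ?L)"
      by (simp add: algebra_simps)
    moreover have "shift_weight ?v \<noteq> []" by (simp add: shift_weight_def)
    ultimately show ?case using Suc by (simp add: length_shift_weight sum_abs_shift)
  qed (use assms in simp)
  from this[of d] show ?thesis using assms(2) by (simp add: dvd_minus_iff)
qed

section \<open>Averaging over signed permutations\<close>

definition weights :: "nat \<Rightarrow> nat \<Rightarrow> int list set" where
  "weights m n = {w. length w = m \<and> (\<Sum>x\<leftarrow>w. \<bar>x\<bar>) \<le> int n \<and> odd (sum_list w)}"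

lemma finite_weights: "finite (weights m n)"
proof (rule finite_subset)
  show "weights m n \<subseteq> {w. set w \<subseteq> {- int n..int n} \<and> length w = m}"
  proof (clarsimp simp: weights_def)
    fix w x assume "(\<Sum>x\<leftarrow>w. \<bar>x\<bar>) \<le> int n" "(x::int) \<in> set w"
    then have "\<bar>x\<bar> \<le> (\<Sum>x\<leftarrow>w. \<bar>x\<bar>)" by (intro member_le_sum_list) auto
    then show "- int n \<le> x \<and> x \<le> int n" using \<open>(\<Sum>x\<leftarrow>w. \<bar>x\<bar>) \<le> int n\<close> by linarith
  qed
qed (simp add: finite_lists_length_eq)

lemma odd_sum_list_abs: "odd (sum_list w) \<longleftrightarrow> odd (\<Sum>x\<leftarrow>w. \<bar>x::int\<bar>)"
  by (induction w) auto

lemma weights_mset_abs: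
  assumes "w \<in> weights m n" "mset (map abs w) = mset (map abs w')"
  shows "w' \<in> weights m n"
proof -
  have "length w = length w'" using assms(2) by (metis size_mset length_map)
  moreover have "(\<Sum>x\<leftarrow>w. \<bar>x\<bar>) = (\<Sum>x\<leftarrow>w'. \<bar>x\<bar>)" 
    using arg_cong[OF assms(2), of sum_mset] by (simp only: sum_mset_sum_list)
  ultimately show ?thesis
    using assms(1) odd_sum_list_abs[of w] odd_sum_list_abs[of w'] by (auto simp: weights_def)
qed

definition flip :: "nat set \<Rightarrow> int list \<Rightarrow> int list" where
  "flip A w = map (\<lambda>i. if i \<in> A then w ! i else - w ! i) [0..<length w]"

lemma map_abs_flip: "map abs (flip A w) = map abs w"
  by (rule nth_equalityI) (auto simp: flip_def)

lemma flip_flip: "flip A (flip A w) = w"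
  by (rule nth_equalityI) (auto simp: flip_def)

text \<open>The coordinate at place \<open>i\<close> is moved to place \<open>xs ! i\<close>, so that the monomial of the result has
the variables \<open>x (xs ! i)\<close> with exponents \<open>w ! i\<close>.\<close>

definition rearrange :: "nat list \<Rightarrow> int list \<Rightarrow> int list" where
  "rearrange xs w = map (\<lambda>j. w ! the_inv_into {..<length xs} ((!) xs) j) [0..<length xs]"

lemma
  assumes xs: "xs \<in> injective_words {..<m} m" and w: "length w = m"
  shows bij_injective_word: "bij_betw ((!) xs) {..<m} {..<m}"
    and nth_rearrange: "i < m \<Longrightarrow> rearrange xs w ! (xs ! i) = w ! i"
    and mset_rearrange: "mset (rearrange xs w) = mset w"
proof -
  have xs': "distinct xs" "set xs \<subseteq> {..<m}" "length xs = m" using xs by (auto simp: injective_words_def)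
  have set: "set xs = {..<m}"
    using xs' by (intro card_subset_eq) (auto simp: distinct_card)
  show bij: "bij_betw ((!) xs) {..<m} {..<m}"
    using bij_betw_nth[OF xs'(1), of "{..<m}" "set xs"] xs'(3) set by auto
  have len: "length (rearrange xs w) = m" by (simp add: rearrange_def xs')
  show nth: "rearrange xs w ! (xs ! i) = w ! i" if "i < m" for i
  proof -
    have "xs ! i < m" using that xs'(3) set nth_mem by blast
    moreover have "the_inv_into {..<m} ((!) xs) (xs ! i) = i"
      using that bij by (intro the_inv_into_f_f) (auto simp: bij_betw_def)
    ultimately show ?thesis by (simp add: rearrange_def xs')
  qed
  have "map ((!) (rearrange xs w)) xs = w"
    by (rule nth_equalityI) (auto simp: w xs' nth)
  then have "mset w = image_mset ((!) (rearrange xs w)) (mset xs)"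
    by (metis mset_map)
  also have "mset xs = mset [0..<m]"
    using xs' set by (intro iffD1[OF set_eq_iff_mset_eq_distinct]) (auto simp: atLeast0LessThan)
  also have "image_mset ((!) (rearrange xs w)) (mset [0..<m]) = mset (rearrange xs w)"
    using map_nth[of "rearrange xs w"] by (simp only: mset_map[symmetric] len)
  finally show "mset (rearrange xs w) = mset w" by simp
qed

text \<open>Each signed permutation permutes the weights and preserves \<open>N\<close>, so the sum equals its average
over all pairs of a word and a set of sign changes.  For a fixed weight, summing over the signs turns
each variable into a symmetric power and summing over the words gives an injective sum.\<close>

lemma sum_signed_permutation_invariant_eq_0:
  fixes N :: "int list \<Rightarrow> nat" and x :: "nat \<Rightarrow> complex"
  assumes inv: "\<And>w w'. length w = m \<Longrightarrow> mset (map abs w) = mset (map abs w') \<Longrightarrow> N w = N w'"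
    and nz: "\<And>j. x j \<noteq> 0"
    and vanish: "\<And>k. odd k \<Longrightarrow> \<bar>k\<bar> \<le> int n \<Longrightarrow> (\<Sum>j<m. sym_power (x j) k) = 0"
  shows "(\<Sum>w\<in>weights m n. of_nat (N w) * (\<Prod>i<m. x i powi (w ! i))) = 0" (is "?X = 0")
proof -
  let ?mon = "\<lambda>w. \<Prod>i<m. x i powi (w ! i)"
  let ?W = "injective_words {..<m} m \<times> Pow {..<m}"
  let ?act = "\<lambda>(xs, A) w. rearrange xs (flip A w)"
  have reindex: "?X = (\<Sum>w\<in>weights m n. of_nat (N w) * ?mon (?act \<sigma> w))" if W: "\<sigma> \<in> ?W" for \<sigma>
  proof -
    obtain xs A where \<sigma>: "\<sigma> = (xs, A)" "xs \<in> injective_words {..<m} m"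
      using W by auto
    let ?f = "\<lambda>w. rearrange xs (flip A w)"
    have len: "length (flip A w) = m" if "w \<in> weights m n" for w
      using that by (simp add: flip_def weights_def)
    have mset: "mset (map abs (?f w)) = mset (map abs w)" if "w \<in> weights m n" for w
      using mset_rearrange[OF \<sigma>(2) len[OF that]] map_abs_flip by (metis mset_map)
    have "inj_on ?f (weights m n)"
    proof (rule inj_onI)
      fix w v assume wv: "w \<in> weights m n" "v \<in> weights m n" "?f w = ?f v"
      have "flip A w = flip A v"
      proof (rule nth_equalityI)
        show "length (flip A w) = length (flip A v)" using wv len by simp
        fix i assume "i < length (flip A w)"
        then have "i < m" using wv len by simp
        then have "flip A w ! i = ?f w ! (xs ! i)" "flip A v ! i = ?f v ! (xs ! i)"
          using nth_rearrange[OF \<sigma>(2) len] wv(1,2) by metis+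
        then show "flip A w ! i = flip A v ! i" using wv(3) by simp
      qed
      then show "w = v" by (metis flip_flip)
    qed
    moreover have sub: "?f ` weights m n \<subseteq> weights m n"
    proof clarify
      fix w assume "w \<in> weights m n"
      then show "?f w \<in> weights m n" 
        by (rule weights_mset_abs) (rule mset[OF \<open>w \<in> weights m n\<close>, symmetric])
    qed
    ultimately have "bij_betw ?f (weights m n) (weights m n)"
      by (auto simp: bij_betw_def endo_inj_surj[OF finite_weights])
    then have "?X = (\<Sum>w\<in>weights m n. of_nat (N (?f w)) * ?mon (?f w))"
      by (rule sum.reindex_bij_betw[symmetric])
    also have "\<dots> = (\<Sum>w\<in>weights m n. of_nat (N w) * ?mon (?f w))"
    proof (intro sum.cong refl)
      fix w assume w: "w \<in> weights m n"
      then have "N w = N (?f w)" using mset[OF w] by (intro inv) (auto simp: weights_def simp del: mset_map)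
      then show "of_nat (N (?f w)) * ?mon (?f w) = of_nat (N w) * ?mon (?f w)" by simp
    qed
    finally show ?thesis by (simp add: \<sigma>)
  qed
  have orbit: "(\<Sum>\<sigma>\<in>?W. ?mon (?act \<sigma> w)) = 0" if w: "w \<in> weights m n" for w
  proof -
    have len: "length w = m" using w by (simp add: weights_def)
    have "(\<Sum>A\<in>Pow {..<m}. ?mon (rearrange xs (flip A w)))
        = (\<Prod>i<m. sym_power (x (xs ! i)) (w ! i))" if xs: "xs \<in> injective_words {..<m} m" for xs
    proof -
      have "?mon (rearrange xs (flip A w))
          = (\<Prod>i\<in>A. x (xs ! i) powi (w ! i)) * (\<Prod>i\<in>{..<m} - A. x (xs ! i) powi (- w ! i))"
        if A: "A \<in> Pow {..<m}" for A
      proof -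
        have l: "length (flip A w) = m" by (simp add: flip_def len)
        have "?mon (rearrange xs (flip A w))
            = (\<Prod>i<m. x (xs ! i) powi (rearrange xs (flip A w) ! (xs ! i)))"
          by (rule prod.reindex_bij_betw[OF bij_injective_word[OF xs l], symmetric])
        also have "\<dots> = (\<Prod>i<m. x (xs ! i) powi (if i \<in> A then w ! i else - w ! i))"
          by (intro prod.cong refl) (subst nth_rearrange[OF xs l], simp_all add: flip_def len)
        also have "\<dots> = (\<Prod>i\<in>{..<m} - A. x (xs ! i) powi (if i \<in> A then w ! i else - w ! i))
            * (\<Prod>i\<in>A. x (xs ! i) powi (if i \<in> A then w ! i else - w ! i))"
          using A by (intro prod.subset_diff) auto
        finally show ?thesis by (simp add: mult.commute)
      qed
      then show ?thesis by (simp add: sym_power_def prod_add)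
    qed
    then have "(\<Sum>\<sigma>\<in>?W. ?mon (?act \<sigma> w))
        = (\<Sum>xs\<in>injective_words {..<m} m. \<Prod>i<m. sym_power (x (xs ! i)) (w ! i))"
      by (simp add: sum.cartesian_product' sum.cartesian_product[symmetric])
    also have "\<dots> = injective_sum {..<m} x (map (\<lambda>k. [k]) w)"
      by (simp add: injective_sum_def len)
    also have "\<dots> = 0"
    proof (rule injective_sum_eq_0[where n = n])
      show "odd (\<Sum>S\<leftarrow>map (\<lambda>k. [k]) w. sum_list S)" "(\<Sum>S\<leftarrow>map (\<lambda>k. [k]) w. \<Sum>k\<leftarrow>S. \<bar>k\<bar>) \<le> int n"
        using w by (simp_all add: weights_def comp_def)
    qed (use nz vanish in auto)
    finally show ?thesis .
  qed
  have "of_nat (card ?W) * ?X = (\<Sum>\<sigma>\<in>?W. ?X)" by simp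
  also have "\<dots> = (\<Sum>\<sigma>\<in>?W. \<Sum>w\<in>weights m n. of_nat (N w) * ?mon (?act \<sigma> w))"
    by (rule sum.cong[OF refl reindex])
  also have "\<dots> = (\<Sum>w\<in>weights m n. of_nat (N w) * (\<Sum>\<sigma>\<in>?W. ?mon (?act \<sigma> w)))"
    by (subst sum.swap) (simp add: sum_distrib_left)
  also have "\<dots> = 0" by (simp add: orbit)
  finally have "of_nat (card ?W) * ?X = 0" .
  moreover have "card ?W \<noteq> 0"
  proof -
    have "([0..<m], {}) \<in> ?W" by (auto simp: injective_words_def)
    moreover have "finite ?W" by (simp add: finite_injective_words)
    ultimately show ?thesis by (metis card_eq_0_iff empty_iff)
  qed
  ultimately show ?thesis by simp
qed

section \<open>Strings on lists\<close>

text \<open>The part of the structure of an \<open>sl\<^sub>2\<close> crystal that is needed: \<open>F\<close> and \<open>E\<close> are partial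
inverses of each other, defined where \<open>phi\<close> respectively \<open>eps\<close> is positive, and move one step along
a string.\<close>

locale string_crystal =
  fixes B :: "'c set" and eps phi :: "'c \<Rightarrow> nat" and F E :: "'c \<Rightarrow> 'c"
  assumes F: "\<And>c. c \<in> B \<Longrightarrow> phi c > 0 \<Longrightarrow>
      F c \<in> B \<and> eps (F c) = Suc (eps c) \<and> Suc (phi (F c)) = phi c \<and> E (F c) = c"
    and E: "\<And>c. c \<in> B \<Longrightarrow> eps c > 0 \<Longrightarrow>
      E c \<in> B \<and> Suc (eps (E c)) = eps c \<and> phi (E c) = Suc (phi c) \<and> F (E c) = c"
begin

text \<open>The tensor product rule.  A list is read from its last entry to its first, each entry contributing
\<open>eps\<close> minus signs followed by \<open>phi\<close> plus signs.  Plus signs cancel against later minus signs;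
\<open>list_F\<close> changes the entry that holds the first surviving plus, \<open>list_E\<close> the entry that holds the last
surviving minus.\<close>

fun list_phi :: "'c list \<Rightarrow> nat" where
  "list_phi [] = 0"
| "list_phi (c # cs) = phi c + (list_phi cs - eps c)"

fun list_eps :: "'c list \<Rightarrow> nat" where
  "list_eps [] = 0"
| "list_eps (c # cs) = list_eps cs + (eps c - list_phi cs)"

fun list_F :: "'c list \<Rightarrow> 'c list" where
  "list_F [] = []"
| "list_F (c # cs) = (if list_phi cs > eps c then c # list_F cs else F c # cs)"

fun list_E :: "'c list \<Rightarrow> 'c list" where
  "list_E [] = []"
| "list_E (c # cs) = (if eps c > list_phi cs then E c # cs else c # list_E cs)"

lemma list_F:
  assumes "set cs \<subseteq> B" "list_phi cs > 0"
  shows "set (list_F cs) \<subseteq> B \<and> list_eps (list_F cs) = Suc (list_eps cs) \<and>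
    Suc (list_phi (list_F cs)) = list_phi cs \<and> list_E (list_F cs) = cs"
  using assms
proof (induction cs)
  case (Cons c cs)
  show ?case
  proof (cases "list_phi cs > eps c")
    case True
    then show ?thesis using Cons by auto
  next
    case False
    then show ?thesis using Cons.prems F[of c] by auto
  qed
qed simp

lemma list_E:
  assumes "set cs \<subseteq> B" "list_eps cs > 0"
  shows "set (list_E cs) \<subseteq> B \<and> Suc (list_eps (list_E cs)) = list_eps cs \<and>
    list_phi (list_E cs) = Suc (list_phi cs) \<and> list_F (list_E cs) = cs"
  using assms
proof (induction cs)
  case (Cons c cs)
  show ?case
  proof (cases "eps c > list_phi cs")
    case True
    then show ?thesis using Cons.prems E[of c] by auto
  next
    case False
    then show ?thesis using Cons by auto
  qed
qed simp

lemma list_weight: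
  "int (list_phi cs) - int (list_eps cs) = (\<Sum>c\<leftarrow>cs. int (phi c) - int (eps c))"
  by (induction cs) auto

text \<open>The plus signs of entry \<open>j\<close> outnumber the minus signs of entry \<open>j - 1\<close>, since one of them
survives; those of entry \<open>j + 1\<close> have all cancelled against the minus signs of entry \<open>j\<close>, since the
survivor in entry \<open>j\<close> is the first.  The last conjunct only carries the
induction.\<close>

lemma list_F_position:
  assumes "list_phi cs > 0"
  shows "\<exists>j<length cs. list_F cs = cs[j := F (cs ! j)] \<and> phi (cs ! j) > 0 \<and>
    (Suc j < length cs \<longrightarrow> phi (cs ! Suc j) \<le> eps (cs ! j)) \<and>
    (\<forall>i. j = Suc i \<longrightarrow> eps (cs ! i) < phi (cs ! j)) \<and> (j = 0 \<longrightarrow> list_phi cs = phi (cs ! 0))"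
  using assms
proof (induction cs)
  case (Cons c cs)
  show ?case
  proof (cases "list_phi cs > eps c")
    case True
    then obtain j where j: "j < length cs" "list_F cs = cs[j := F (cs ! j)]" "phi (cs ! j) > 0"
      "Suc j < length cs \<longrightarrow> phi (cs ! Suc j) \<le> eps (cs ! j)"
      "\<forall>i. j = Suc i \<longrightarrow> eps (cs ! i) < phi (cs ! j)" "j = 0 \<longrightarrow> list_phi cs = phi (cs ! 0)"
      using Cons.IH by auto
    show ?thesis
      using True j by (intro exI[of _ "Suc j"]) (auto simp: gr0_conv_Suc nth_Cons split: nat.splits)
  next
    case False
    have "phi (cs ! 0) \<le> eps c" if "cs \<noteq> []"
      using False that by (cases cs) auto
    then show ?thesis using False Cons.prems by (intro exI[of _ 0]) auto
  qed
qed simp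

lemma list_E_position:
  assumes "list_eps cs > 0"
  shows "\<exists>j<length cs. list_E cs = cs[j := E (cs ! j)] \<and> eps (cs ! j) > 0 \<and>
    (Suc j < length cs \<longrightarrow> phi (cs ! Suc j) < eps (cs ! j)) \<and>
    (\<forall>i. j = Suc i \<longrightarrow> eps (cs ! i) \<le> phi (cs ! j)) \<and> (j = 0 \<longrightarrow> list_phi cs = phi (cs ! 0))"
  using assms
proof (induction cs)
  case (Cons c cs)
  show ?case
  proof (cases "eps c > list_phi cs")
    case True
    have "phi (cs ! 0) < eps c" if "cs \<noteq> []"
      using True that by (cases cs) auto
    then show ?thesis using True Cons.prems by (intro exI[of _ 0]) auto
  next
    case False
    then obtain j where j: "j < length cs" "list_E cs = cs[j := E (cs ! j)]" "eps (cs ! j) > 0"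
      "Suc j < length cs \<longrightarrow> phi (cs ! Suc j) < eps (cs ! j)"
      "\<forall>i. j = Suc i \<longrightarrow> eps (cs ! i) \<le> phi (cs ! j)" "j = 0 \<longrightarrow> list_phi cs = phi (cs ! 0)"
      using Cons by auto
    show ?thesis
      using False j by (intro exI[of _ "Suc j"]) (auto simp: gr0_conv_Suc nth_Cons split: nat.splits)
  qed
qed simp

text \<open>Lists of given length with a condition on each entry and on each pair of neighbours, both of which
may depend on the position.\<close>

definition chains :: "nat \<Rightarrow> (nat \<Rightarrow> 'c \<Rightarrow> 'c \<Rightarrow> bool) \<Rightarrow> (nat \<Rightarrow> 'c \<Rightarrow> bool) \<Rightarrow> 'c list set" where
  "chains K R P = {cs. length cs = K \<and> set cs \<subseteq> B \<and> (\<forall>j<K. P j (cs ! j)) \<and>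
     (\<forall>j. Suc j < K \<longrightarrow> R j (cs ! j) (cs ! Suc j))}"

text \<open>By the inequalities of \<open>list_F_position\<close>, the entry that changes is the one that changes in the
tensor product of the entry with either neighbour.\<close>

lemma list_F_chains:
  assumes P: "\<And>j c. c \<in> B \<Longrightarrow> P j c \<Longrightarrow> phi c > 0 \<Longrightarrow> P j (F c)"
    and R1: "\<And>j c d. c \<in> B \<Longrightarrow> d \<in> B \<Longrightarrow> R j c d \<Longrightarrow> eps c < phi d \<Longrightarrow> R j c (F d)"
    and R2: "\<And>j c d. c \<in> B \<Longrightarrow> d \<in> B \<Longrightarrow> R j c d \<Longrightarrow> phi d \<le> eps c \<Longrightarrow> phi c > 0 \<Longrightarrow> R j (F c) d"
    and cs: "cs \<in> chains K R P" "list_phi cs > 0"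
  shows "list_F cs \<in> chains K R P"
proof -
  have cs': "length cs = K" "set cs \<subseteq> B" "\<And>j. j < K \<Longrightarrow> P j (cs ! j)"
    "\<And>j. Suc j < K \<Longrightarrow> R j (cs ! j) (cs ! Suc j)" using cs(1) by (auto simp: chains_def)
  obtain j where j: "j < length cs" "list_F cs = cs[j := F (cs ! j)]" "phi (cs ! j) > 0"
    "Suc j < length cs \<Longrightarrow> phi (cs ! Suc j) \<le> eps (cs ! j)"
    "\<And>i. j = Suc i \<Longrightarrow> eps (cs ! i) < phi (cs ! j)"
    using list_F_position[OF cs(2)] by blast
  have inB: "cs ! i \<in> B" if "i < K" for i using cs' that by auto
  have "R i (list_F cs ! i) (list_F cs ! Suc i)" if "Suc i < K" for i
    using that j cs' inB by (auto simp: nth_list_update intro: R1 R2)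
  moreover have "P i (list_F cs ! i)" if "i < K" for i
    using that j cs' inB by (auto simp: nth_list_update intro: P)
  moreover have "set (list_F cs) \<subseteq> B" using list_F cs' cs by blast
  ultimately show ?thesis using cs'(1) j(2) by (auto simp: chains_def)
qed

lemma list_E_chains:
  assumes P: "\<And>j c. c \<in> B \<Longrightarrow> P j c \<Longrightarrow> eps c > 0 \<Longrightarrow> P j (E c)"
    and R1: "\<And>j c d. c \<in> B \<Longrightarrow> d \<in> B \<Longrightarrow> R j c d \<Longrightarrow> eps c \<le> phi d \<Longrightarrow> eps d > 0 \<Longrightarrow> R j c (E d)"
    and R2: "\<And>j c d. c \<in> B \<Longrightarrow> d \<in> B \<Longrightarrow> R j c d \<Longrightarrow> phi d < eps c \<Longrightarrow> R j (E c) d"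
    and cs: "cs \<in> chains K R P" "list_eps cs > 0"
  shows "list_E cs \<in> chains K R P"
proof -
  have cs': "length cs = K" "set cs \<subseteq> B" "\<And>j. j < K \<Longrightarrow> P j (cs ! j)"
    "\<And>j. Suc j < K \<Longrightarrow> R j (cs ! j) (cs ! Suc j)" using cs(1) by (auto simp: chains_def)
  obtain j where j: "j < length cs" "list_E cs = cs[j := E (cs ! j)]" "eps (cs ! j) > 0"
    "Suc j < length cs \<Longrightarrow> phi (cs ! Suc j) < eps (cs ! j)"
    "\<And>i. j = Suc i \<Longrightarrow> eps (cs ! i) \<le> phi (cs ! j)"
    using list_E_position[OF cs(2)] by blast
  have inB: "cs ! i \<in> B" if "i < K" for i using cs' that by auto
  have "R i (list_E cs ! i) (list_E cs ! Suc i)" if "Suc i < K" for i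
    using that j cs' inB by (auto simp: nth_list_update intro: R1 R2)
  moreover have "P i (list_E cs ! i)" if "i < K" for i
    using that j cs' inB by (auto simp: nth_list_update intro: P)
  moreover have "set (list_E cs) \<subseteq> B" using list_E cs' cs by blast
  ultimately show ?thesis using cs'(1) j(2) by (auto simp: chains_def)
qed

lemma list_F_funpow:
  assumes closed: "\<And>cs. cs \<in> Q \<Longrightarrow> list_phi cs > 0 \<Longrightarrow> list_F cs \<in> Q" and Q: "\<And>cs. cs \<in> Q \<Longrightarrow> set cs \<subseteq> B"
  shows "cs \<in> Q \<Longrightarrow> k \<le> list_phi cs \<Longrightarrow> (list_F ^^ k) cs \<in> Q \<and>
    list_phi ((list_F ^^ k) cs) + k = list_phi cs \<and>
    list_eps ((list_F ^^ k) cs) = list_eps cs + k \<and> (list_E ^^ k) ((list_F ^^ k) cs) = cs"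
proof (induction k)
  case (Suc k)
  let ?d = "(list_F ^^ k) cs"
  have d: "?d \<in> Q" "list_phi ?d + k = list_phi cs" "list_eps ?d = list_eps cs + k" "(list_E ^^ k) ?d = cs" using Suc by auto
  have "list_phi ?d > 0" using d Suc.prems by simp
  then show ?case using list_F[OF Q[OF d(1)]] closed[OF d(1)] d
    by (auto simp del: funpow.simps simp: funpow_Suc_right[of k list_E] funpow.simps(2)[of k list_F])
qed simp

lemma list_E_funpow:
  assumes closed: "\<And>cs. cs \<in> Q \<Longrightarrow> list_eps cs > 0 \<Longrightarrow> list_E cs \<in> Q" and Q: "\<And>cs. cs \<in> Q \<Longrightarrow> set cs \<subseteq> B"
  shows "cs \<in> Q \<Longrightarrow> k \<le> list_eps cs \<Longrightarrow> (list_E ^^ k) cs \<in> Q \<and>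
    list_eps ((list_E ^^ k) cs) + k = list_eps cs \<and>
    list_phi ((list_E ^^ k) cs) = list_phi cs + k \<and> (list_F ^^ k) ((list_E ^^ k) cs) = cs"
proof (induction k)
  case (Suc k)
  let ?d = "(list_E ^^ k) cs"
  have d: "?d \<in> Q" "list_eps ?d + k = list_eps cs" "list_phi ?d = list_phi cs + k" "(list_F ^^ k) ?d = cs" using Suc by auto
  have "list_eps ?d > 0" using d Suc.prems by simp
  then show ?case using list_E[OF Q[OF d(1)]] closed[OF d(1)] d
    by (auto simp del: funpow.simps simp: funpow_Suc_right[of k list_F] funpow.simps(2)[of k list_E])
qed simp

lemma sum_list_list_F:
  assumes "\<And>c. c \<in> B \<Longrightarrow> phi c > 0 \<Longrightarrow> h (F c) = h c"
  shows "set cs \<subseteq> B \<Longrightarrow> list_phi cs > 0 \<Longrightarrow> (\<Sum>c\<leftarrow>list_F cs. (h c :: int)) = (\<Sum>c\<leftarrow>cs. h c)"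
  by (induction cs) (auto simp: assms)

lemma sum_list_list_E:
  assumes "\<And>c. c \<in> B \<Longrightarrow> phi c > 0 \<Longrightarrow> h (F c) = h c" "set cs \<subseteq> B" "list_eps cs > 0"
  shows "(\<Sum>c\<leftarrow>list_E cs. (h c :: int)) = (\<Sum>c\<leftarrow>cs. h c)"
  using sum_list_list_F[of h "list_E cs", OF assms(1)] list_E[OF assms(2,3)] by simp

text \<open>On lists of weight \<open>k \<ge> 0\<close>, the \<open>k\<close>-fold iterate of \<open>list_F\<close> is defined, has weight \<open>- k\<close>
and is undone by the iterate of \<open>list_E\<close>.  The family \<open>h\<close> collects statistics that are constant
along strings.\<close>

theorem card_weight_symmetric:
  fixes h :: "'c \<Rightarrow> 'i \<Rightarrow> int"
  assumes Q: "\<And>cs. cs \<in> Q \<Longrightarrow> set cs \<subseteq> B"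
    and closed_F: "\<And>cs. cs \<in> Q \<Longrightarrow> list_phi cs > 0 \<Longrightarrow> list_F cs \<in> Q"
    and closed_E: "\<And>cs. cs \<in> Q \<Longrightarrow> list_eps cs > 0 \<Longrightarrow> list_E cs \<in> Q"
    and h: "\<And>c. c \<in> B \<Longrightarrow> phi c > 0 \<Longrightarrow> h (F c) = h c"
  shows "card {cs \<in> Q. (\<forall>i\<in>I. (\<Sum>c\<leftarrow>cs. h c i) = s i) \<and> (\<Sum>c\<leftarrow>cs. int (phi c) - int (eps c)) = d}
       = card {cs \<in> Q. (\<forall>i\<in>I. (\<Sum>c\<leftarrow>cs. h c i) = s i) \<and> (\<Sum>c\<leftarrow>cs. int (phi c) - int (eps c)) = - d}"
proof -
  define Qs where "Qs = {cs \<in> Q. \<forall>i\<in>I. (\<Sum>c\<leftarrow>cs. h c i) = s i}"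
  define A where "A d = {cs \<in> Qs. int (list_phi cs) - int (list_eps cs) = d}" for d
  have Qs: "set cs \<subseteq> B" if "cs \<in> Qs" for cs using that Q by (auto simp: Qs_def)
  have hF: "(\<Sum>c\<leftarrow>list_F cs. h c i) = (\<Sum>c\<leftarrow>cs. h c i)" if "cs \<in> Qs" "list_phi cs > 0" for cs i
    using sum_list_list_F[of "\<lambda>c. h c i" cs] that Qs h by auto
  have hE: "(\<Sum>c\<leftarrow>list_E cs. h c i) = (\<Sum>c\<leftarrow>cs. h c i)" if "cs \<in> Qs" "list_eps cs > 0" for cs i
    using sum_list_list_E[of "\<lambda>c. h c i" cs] that Qs h by auto
  have F': "list_F cs \<in> Qs" if "cs \<in> Qs" "list_phi cs > 0" for cs
    using that closed_F[of cs] hF[OF that] by (auto simp: Qs_def)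
  have E': "list_E cs \<in> Qs" if "cs \<in> Qs" "list_eps cs > 0" for cs
    using that closed_E[of cs] hE[OF that] by (auto simp: Qs_def)
  have pos: "card (A (int k)) = card (A (- int k))" for k
  proof (rule bij_betw_same_card)
    have Fk: "(list_F ^^ k) cs \<in> A (- int k) \<and> (list_E ^^ k) ((list_F ^^ k) cs) = cs" if "cs \<in> A (int k)" for cs
      using that list_F_funpow[of Qs cs k, OF F' Qs] by (auto simp: A_def)
    have Ek: "(list_E ^^ k) cs \<in> A (int k) \<and> (list_F ^^ k) ((list_E ^^ k) cs) = cs" if "cs \<in> A (- int k)" for cs
      using that list_E_funpow[of Qs cs k, OF E' Qs] by (auto simp: A_def)
    show "bij_betw (list_F ^^ k) (A (int k)) (A (- int k))"
      using Fk Ek by (intro bij_betw_byWitness[where f' = "list_E ^^ k"]) auto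
  qed
  have "card (A d) = card (A (- d))"
    using pos[of "nat d"] pos[of "nat (- d)"] by (cases "d \<ge> 0") auto
  then show ?thesis by (simp add: A_def Qs_def list_weight conj_assoc)
qed

end

section \<open>Splitting column sets\<close>

definition doubles :: "letter set \<Rightarrow> nat set" where
  "doubles X = {z. Unbarred z \<in> X \<and> Barred z \<in> X}"

definition free_letters :: "nat \<Rightarrow> letter set \<Rightarrow> nat set" where
  "free_letters m X = {t \<in> {1..m}. Unbarred t \<notin> X \<and> Barred t \<notin> X}"

definition descending :: "nat set \<Rightarrow> nat list" where
  "descending A = rev (sorted_list_of_set A)"

text \<open>The greedy choice of the letters \<open>t\<^sub>i\<close> among \<open>A\<close> for the letters \<open>z\<^sub>i\<close> in \<open>zs\<close>, as a
recursion; \<open>b\<close> is a strict upper bound, which after the first step is the letter chosen last.\<close>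

fun greedy :: "nat set \<Rightarrow> nat \<Rightarrow> nat list \<Rightarrow> nat list \<Rightarrow> bool" where
  "greedy A b [] ts \<longleftrightarrow> ts = []"
| "greedy A b (z # zs) [] \<longleftrightarrow> False"
| "greedy A b (z # zs) (t # ts) \<longleftrightarrow>
     t \<in> A \<and> t < z \<and> t < b \<and> (\<forall>x\<in>A. x < z \<and> x < b \<longrightarrow> x \<le> t) \<and> greedy A t zs ts"

lemma greedy_unique: "greedy A b zs ts \<Longrightarrow> greedy A b zs ts' \<Longrightarrow> ts = ts'"
proof (induction A b zs ts arbitrary: ts' rule: greedy.induct)
  case (3 A b z zs t ts)
  then obtain t' us where ts': "ts' = t' # us" by (cases ts') auto
  have "t' \<le> t" "t \<le> t'" using 3(2,3) by (auto simp: ts')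
  then show ?case using 3 by (auto simp: ts')
qed auto

lemma greedy_length: "greedy A b zs ts \<Longrightarrow> length ts = length zs"
  by (induction A b zs ts rule: greedy.induct) auto

lemma greedy_bounds: "greedy A b zs ts \<Longrightarrow> set ts \<subseteq> {t \<in> A. t < b} \<and> distinct ts \<and> (\<forall>i<length ts. ts ! i < zs ! i)"
proof (induction A b zs ts rule: greedy.induct)
  case (3 A b z zs t ts)
  then have IH: "set ts \<subseteq> {t' \<in> A. t' < t}" "distinct ts" "\<And>i. i < length ts \<Longrightarrow> ts ! i < zs ! i"
    and t: "t \<in> A" "t < z" "t < b" by simp_all
  have "(t # ts) ! i < (z # zs) ! i" if "i < length (t # ts)" for i
    using that IH(3) t by (cases i) auto
  moreover have "set (t # ts) \<subseteq> {t \<in> A. t < b}" "distinct (t # ts)" using IH(1,2) t by auto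
  ultimately show ?case by blast
qed simp_all

lemma greedy_restrict: "b \<le> p \<Longrightarrow> greedy A b zs ts = greedy {t \<in> A. t < p} b zs ts"
proof (induction A b zs ts rule: greedy.induct)
  case (3 A b z zs t ts)
  have "greedy A t zs ts = greedy {t \<in> A. t < p} t zs ts" if "t < b"
    using that 3 by simp
  moreover have "(\<forall>x\<in>A. x < z \<and> x < b \<longrightarrow> x \<le> t) = (\<forall>x\<in>{t \<in> A. t < p}. x < z \<and> x < b \<longrightarrow> x \<le> t)"
    using 3(2) by auto
  ultimately show ?case using 3(2) by auto
qed simp_all

text \<open>The first letter chosen depends on \<open>z\<close> and \<open>b\<close> only through the free letters below both.\<close>

lemma greedy_cap:
  assumes "p \<le> z" "p \<le> b" "\<forall>t\<in>A. t < z \<and> t < b \<longrightarrow> t < p"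
  shows "greedy A b (z # zs) ts = greedy {t \<in> A. t < p} p (p # zs) ts"
proof (cases ts)
  case (Cons t ts')
  have "t < p \<Longrightarrow> greedy A t zs ts' = greedy {t \<in> A. t < p} t zs ts'" by (rule greedy_restrict) simp
  then show ?thesis using assms by (auto simp: Cons)
qed simp

lemma greedy_below:
  assumes "\<forall>z\<in>set zs. z < p" "p \<le> b"
  shows "greedy A b zs ts = greedy {t \<in> A. t < p} p zs ts"
proof -
  have "greedy A b zs ts = greedy A p zs ts"
  proof (cases zs)
    case (Cons z zs')
    have "x < z \<and> x < b \<longleftrightarrow> x < z \<and> x < p" for x using assms Cons by auto
    then show ?thesis by (cases ts) (auto simp: Cons)
  qed simp
  also have "\<dots> = greedy {t \<in> A. t < p} p zs ts" by (rule greedy_restrict) simp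
  finally show ?thesis .
qed

text \<open>Column sets instead of sorted lists.  Here \<open>Suc m\<close> is a bound that no letter reaches.\<close>

definition admissible_set :: "nat \<Rightarrow> letter set \<Rightarrow> bool" where
  "admissible_set m X \<longleftrightarrow> X \<subseteq> alphabet m \<and>
     (\<exists>ts. greedy (free_letters m X) (Suc m) (descending (doubles X)) ts)"

definition splitting :: "nat \<Rightarrow> letter set \<Rightarrow> nat list" where
  "splitting m X = (THE ts. greedy (free_letters m X) (Suc m) (descending (doubles X)) ts)"

definition left_set :: "nat \<Rightarrow> letter set \<Rightarrow> letter set" where
  "left_set m X = (X - Unbarred ` doubles X) \<union> Unbarred ` set (splitting m X)"

definition right_set :: "nat \<Rightarrow> letter set \<Rightarrow> letter set" where
  "right_set m X = (X - Barred ` doubles X) \<union> Barred ` set (splitting m X)"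

lemma splitting_eqI:
  "greedy (free_letters m X) (Suc m) (descending (doubles X)) ts \<Longrightarrow> splitting m X = ts"
  unfolding splitting_def by (rule the_equality) (auto intro: greedy_unique)

lemma finite_alphabet: "finite (alphabet m)"
  by (simp add: alphabet_def)

lemma finite_doubles: "finite X \<Longrightarrow> finite (doubles X)"
  by (rule finite_subset[of _ "Unbarred -` X"]) (auto simp: doubles_def intro: finite_vimageI injI)

lemma
  assumes "admissible_set m X"
  shows greedy_splitting: "greedy (free_letters m X) (Suc m) (descending (doubles X)) (splitting m X)"
    and splitting_free: "set (splitting m X) \<subseteq> free_letters m X"
    and distinct_splitting: "distinct (splitting m X)"
    and length_splitting: "length (splitting m X) = card (doubles X)"
proof -
  obtain ts where ts: "greedy (free_letters m X) (Suc m) (descending (doubles X)) ts"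
    using assms by (auto simp: admissible_set_def)
  then show g: "greedy (free_letters m X) (Suc m) (descending (doubles X)) (splitting m X)"
    using splitting_eqI by metis
  show "set (splitting m X) \<subseteq> free_letters m X" "distinct (splitting m X)"
    using greedy_bounds[OF g] by auto
  have "finite (doubles X)"
    using assms finite_doubles finite_subset[OF _ finite_alphabet] by (auto simp: admissible_set_def)
  then show "length (splitting m X) = card (doubles X)"
    using greedy_length[OF g] by (simp add: descending_def)
qed

lemma
  assumes "admissible_set m X"
  shows left_set_alphabet: "left_set m X \<subseteq> alphabet m"
    and right_set_alphabet: "right_set m X \<subseteq> alphabet m"
  using assms splitting_free[OF assms]
  by (auto simp: left_set_def right_set_def admissible_set_def alphabet_def free_letters_def)

section \<open>The four middle letters of a column\<close>

text \<open>The operators act on the letters \<open>m - 1\<close>, \<open>m\<close>, \<open>m\<close> barred, \<open>m - 1\<close> barred; with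
\<open>m = Suc p\<close> these are \<open>p\<close>, \<open>Suc p\<close> and their barred versions.  A pattern records, in this order,
which of them a column contains.\<close>

type_synonym bits = "bool \<times> bool \<times> bool \<times> bool"

text \<open>Read from top to bottom, \<open>m - 1\<close> and \<open>m\<close> barred count as plus, \<open>m\<close> and \<open>m - 1\<close> barred as
minus, and a plus cancels against a minus below it.  The functions count the surviving signs.\<close>

fun bits_phi :: "bits \<Rightarrow> nat" where
  "bits_phi (a, b, b', a') = of_bool (b' \<and> \<not> a') + (of_bool (a \<and> \<not> b) - of_bool (a' \<and> \<not> b'))"

fun bits_eps :: "bits \<Rightarrow> nat" where
  "bits_eps (a, b, b', a') = of_bool (b \<and> \<not> a) + (of_bool (a' \<and> \<not> b') - of_bool (a \<and> \<not> b))"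

fun bits_F :: "bits \<Rightarrow> bits" where
  "bits_F (a, b, b', a') =
     (if a \<and> \<not> b \<and> \<not> (a' \<and> \<not> b') then (False, True, b', a') else (a, b, False, True))"

fun bits_E :: "bits \<Rightarrow> bits" where
  "bits_E (a, b, b', a') =
     (if a' \<and> \<not> b' \<and> \<not> (a \<and> \<not> b) then (a, b, True, False) else (True, False, b', a'))"

text \<open>The patterns of \<open>rC\<close> and \<open>lC\<close>.  The letter chosen for the double letter \<open>m\<close> is \<open>m - 1\<close> if
neither \<open>m - 1\<close> nor its barred version occurs; in all other cases the chosen letters are below
\<open>m - 1\<close>.\<close>

fun bits_right :: "bits \<Rightarrow> bits" where
  "bits_right (a, b, b', a') = (a, b, b' \<and> \<not> b, (a' \<and> \<not> a) \<or> (b \<and> b' \<and> \<not> a \<and> \<not> a'))"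

fun bits_left :: "bits \<Rightarrow> bits" where
  "bits_left (a, b, b', a') = ((a \<and> \<not> a') \<or> (b \<and> b' \<and> \<not> a \<and> \<not> a'), b \<and> \<not> b', b', a')"

text \<open>The number of double letters among \<open>m - 1\<close> and \<open>m\<close> for which a letter below \<open>m - 1\<close> has to be
chosen.  The letters chosen below \<open>m - 1\<close> depend on the pattern only through this number.\<close>

fun bits_need :: "bits \<Rightarrow> nat" where
  "bits_need (a, b, b', a') = of_bool (a \<and> a') + of_bool (b \<and> b' \<and> (a \<or> a'))"

fun bits_size :: "bits \<Rightarrow> nat" where
  "bits_size (a, b, b', a') = of_bool a + of_bool b + of_bool b' + of_bool a'"

text \<open>The comparison of two columns at the three thresholds that separate the four letters; \<open>k\<close> is the
lead of the first column below \<open>m - 1\<close>.\<close>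

fun bits_dominate :: "nat \<Rightarrow> bits \<Rightarrow> bits \<Rightarrow> bool" where
  "bits_dominate k (a, b, b', a') (c, d, d', c') \<longleftrightarrow>
     of_bool c \<le> k + of_bool a \<and>
     of_bool c + of_bool d \<le> k + (of_bool a + of_bool b) \<and>
     of_bool c + of_bool d + of_bool d' \<le> k + (of_bool a + of_bool b + of_bool b')"

lemma bits_F:
  assumes "bits_phi q > 0"
  shows "bits_eps (bits_F q) = Suc (bits_eps q)" "Suc (bits_phi (bits_F q)) = bits_phi q"
    "bits_E (bits_F q) = q" "bits_need (bits_F q) = bits_need q" "bits_size (bits_F q) = bits_size q"
    "bits_size (bits_right (bits_F q)) = bits_size (bits_right q)"
    "bits_size (bits_left (bits_F q)) = bits_size (bits_left q)"
proof (atomize(full), goal_cases)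
  case 1
  obtain a b b' a' where q: "q = (a, b, b', a')" by (cases q) auto
  show ?case using assms unfolding q by (cases a; cases b; cases b'; cases a'; simp)
qed

lemma bits_E:
  assumes "bits_eps q > 0"
  shows "Suc (bits_eps (bits_E q)) = bits_eps q" "bits_phi (bits_E q) = Suc (bits_phi q)"
    "bits_F (bits_E q) = q"
proof (atomize(full), goal_cases)
  case 1
  obtain a b b' a' where q: "q = (a, b, b', a')" by (cases q) auto
  show ?case using assms unfolding q by (cases a; cases b; cases b'; cases a'; simp)
qed

lemma bits_E_more:
  assumes "bits_eps q > 0"
  shows "bits_need (bits_E q) = bits_need q" "bits_size (bits_E q) = bits_size q"
    "bits_size (bits_right (bits_E q)) = bits_size (bits_right q)"
    "bits_size (bits_left (bits_E q)) = bits_size (bits_left q)"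
  using bits_F(4-7)[of "bits_E q"] bits_E[OF assms] by simp_all

text \<open>The tensor product rule on two adjacent columns: the side conditions say which of the two columns
changes.  Changing the other one could violate the comparison.  The first premise is the comparison
at the upper end of the four letters.\<close>

lemma
  assumes "bits_size (bits_left d) \<le> k + bits_size (bits_right c)"
    and "bits_dominate k (bits_right c) (bits_left d)"
  shows bits_F_right: "bits_eps c < bits_phi d \<Longrightarrow> bits_dominate k (bits_right c) (bits_left (bits_F d))"
    and bits_F_left: "bits_phi d \<le> bits_eps c \<and> bits_phi c > 0 \<Longrightarrow> bits_dominate k (bits_right (bits_F c)) (bits_left d)"
    and bits_E_right: "bits_eps c \<le> bits_phi d \<and> bits_eps d > 0 \<Longrightarrow> bits_dominate k (bits_right c) (bits_left (bits_E d))"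
    and bits_E_left: "bits_phi d < bits_eps c \<Longrightarrow> bits_dominate k (bits_right (bits_E c)) (bits_left d)"
proof -
  have "\<forall>c d. bits_size (bits_left d) \<le> k + bits_size (bits_right c) \<longrightarrow>
      bits_dominate k (bits_right c) (bits_left d) \<longrightarrow> bits_eps c < bits_phi d \<longrightarrow> bits_dominate k (bits_right c) (bits_left (bits_F d))"
    by (simp add: split_paired_All all_bool_eq)
  then show "bits_eps c < bits_phi d \<Longrightarrow> bits_dominate k (bits_right c) (bits_left (bits_F d))" using assms by blast
  have "\<forall>c d. bits_size (bits_left d) \<le> k + bits_size (bits_right c) \<longrightarrow>
      bits_dominate k (bits_right c) (bits_left d) \<longrightarrow> bits_phi d \<le> bits_eps c \<and> bits_phi c > 0 \<longrightarrow> bits_dominate k (bits_right (bits_F c)) (bits_left d)"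
    by (simp add: split_paired_All all_bool_eq)
  then show "bits_phi d \<le> bits_eps c \<and> bits_phi c > 0 \<Longrightarrow> bits_dominate k (bits_right (bits_F c)) (bits_left d)" using assms by blast
  have "\<forall>c d. bits_size (bits_left d) \<le> k + bits_size (bits_right c) \<longrightarrow>
      bits_dominate k (bits_right c) (bits_left d) \<longrightarrow> bits_eps c \<le> bits_phi d \<and> bits_eps d > 0 \<longrightarrow> bits_dominate k (bits_right c) (bits_left (bits_E d))"
    by (simp add: split_paired_All all_bool_eq)
  then show "bits_eps c \<le> bits_phi d \<and> bits_eps d > 0 \<Longrightarrow> bits_dominate k (bits_right c) (bits_left (bits_E d))" using assms by blast
  have "\<forall>c d. bits_size (bits_left d) \<le> k + bits_size (bits_right c) \<longrightarrow>
      bits_dominate k (bits_right c) (bits_left d) \<longrightarrow> bits_phi d < bits_eps c \<longrightarrow> bits_dominate k (bits_right (bits_E c)) (bits_left d)"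
    by (simp add: split_paired_All all_bool_eq)
  then show "bits_phi d < bits_eps c \<Longrightarrow> bits_dominate k (bits_right (bits_E c)) (bits_left d)" using assms by blast
qed

text \<open>The four middle letters of the alphabet with \<open>m = Suc p\<close>.\<close>

definition inner :: "nat \<Rightarrow> letter set" where
  "inner p = {Unbarred p, Unbarred (Suc p), Barred (Suc p), Barred p}"

definition bits :: "nat \<Rightarrow> letter set \<Rightarrow> bits" where
  "bits p X = (Unbarred p \<in> X, Unbarred (Suc p) \<in> X, Barred (Suc p) \<in> X, Barred p \<in> X)"

fun with_bits :: "nat \<Rightarrow> bits \<Rightarrow> letter set \<Rightarrow> letter set" where
  "with_bits p (a, b, b', a') X = (X - inner p) \<union>
     {x. a \<and> x = Unbarred p \<or> b \<and> x = Unbarred (Suc p) \<or> b' \<and> x = Barred (Suc p) \<or> a' \<and> x = Barred p}"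

lemma with_bits_outside: "x \<notin> inner p \<Longrightarrow> x \<in> with_bits p q X \<longleftrightarrow> x \<in> X"
  by (cases q) (simp add: inner_def)

lemma bits_with_bits [simp]: "bits p (with_bits p q X) = q"
  by (cases q) (simp add: bits_def inner_def)

lemma outer_with_bits [simp]: "with_bits p q X - inner p = X - inner p"
  using with_bits_outside[of _ p q X] by blast

lemma bits_outer_eqI:
  assumes "bits p X = bits p Y" "X - inner p = Y - inner p"
  shows "X = Y"
proof (rule Set.set_eqI)
  fix x
  show "x \<in> X \<longleftrightarrow> x \<in> Y"
  proof (cases "x \<in> inner p")
    case True
    then show ?thesis using assms(1) by (auto simp: bits_def inner_def)
  next
    case False
    then show ?thesis using assms(2) by blast
  qed
qed

lemma with_bits_alphabet:
  assumes "p > 0" "X \<subseteq> alphabet (Suc p)"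
  shows "with_bits p q X \<subseteq> alphabet (Suc p)"
proof
  fix x assume "x \<in> with_bits p q X"
  then have "x \<in> inner p \<or> x \<in> X" using with_bits_outside by blast
  then show "x \<in> alphabet (Suc p)" using assms by (auto simp: inner_def alphabet_def)
qed

section \<open>Comparing adjacent columns by ranks\<close>

definition rank :: "letter \<Rightarrow> letter set \<Rightarrow> nat" where
  "rank c X = card {x \<in> X. x < c}"

text \<open>Column \<open>L\<close> stands to the right of column \<open>R\<close> and begins \<open>d\<close> rows higher.\<close>

definition dominates :: "nat \<Rightarrow> letter set \<Rightarrow> letter set \<Rightarrow> bool" where
  "dominates d R L \<longleftrightarrow> (\<forall>c. rank c L \<le> d + rank c R)"

lemma letter_less_simps [simp]:
  "Unbarred i < Unbarred j \<longleftrightarrow> i < j" "Unbarred i < Barred j"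
  "\<not> Barred i < Unbarred j" "Barred i < Barred j \<longleftrightarrow> j < i"
  by (auto simp: less_letter_def)

lemma finite_inner [simp]: "finite (inner p)"
  by (simp add: inner_def)

lemma card_filter_inner:
  "card {x \<in> inner p. P x} = of_bool (P (Unbarred p)) + of_bool (P (Unbarred (Suc p)))
     + of_bool (P (Barred (Suc p))) + of_bool (P (Barred p))"
proof -
  have "(\<Sum>x\<in>inner p. of_bool (P x)) = (of_nat (card (inner p \<inter> {x. P x})) :: nat)"
    by (intro sum_of_bool_eq) simp_all
  moreover have "inner p \<inter> {x. P x} = {x \<in> inner p. P x}" by auto
  moreover have "(\<Sum>x\<in>inner p. of_bool (P x)) = (of_bool (P (Unbarred p)) + of_bool (P (Unbarred (Suc p)))
     + of_bool (P (Barred (Suc p))) + of_bool (P (Barred p)) :: nat)"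
    by (simp add: inner_def)
  ultimately show ?thesis by simp
qed

lemma rank_split:
  assumes "finite X"
  shows "rank c X = rank c (X - inner p) +
    (of_bool (Unbarred p \<in> X \<and> Unbarred p < c) + of_bool (Unbarred (Suc p) \<in> X \<and> Unbarred (Suc p) < c)
     + of_bool (Barred (Suc p) \<in> X \<and> Barred (Suc p) < c) + of_bool (Barred p \<in> X \<and> Barred p < c))"
proof -
  have "{x \<in> X. x < c} = {x \<in> X - inner p. x < c} \<union> {x \<in> inner p. x \<in> X \<and> x < c}" by auto
  then have "rank c X = card ({x \<in> X - inner p. x < c} \<union> {x \<in> inner p. x \<in> X \<and> x < c})"
    by (simp only: rank_def)
  also have "\<dots> = rank c (X - inner p) + card {x \<in> inner p. x \<in> X \<and> x < c}"
    unfolding rank_def using assms by (intro card_Un_disjoint) auto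
  finally have "rank c X = rank c (X - inner p) + card {x \<in> inner p. x \<in> X \<and> x < c}" .
  then show ?thesis by (simp only: card_filter_inner)
qed

text \<open>No letter outside the four lies between \<open>p\<close> and \<open>p\<close> barred.  The upper end \<open>Barred (p - 1)\<close> is a
threshold just above the four letters; it is available also for \<open>p = 1\<close>, where it is no letter of
the alphabet.\<close>

lemma rank_outer:
  assumes "X \<subseteq> alphabet (Suc p)" "Unbarred p \<le> c" "c \<le> Barred (p - 1)" "p > 0"
  shows "rank c (X - inner p) = rank (Unbarred p) (X - inner p)"
proof -
  have "x < c \<longleftrightarrow> x < Unbarred p" if "x \<in> X - inner p" for x
  proof -
    have "x \<in> alphabet (Suc p)" "x \<notin> inner p" using that assms(1) by auto
    then have "x < Unbarred p \<or> Barred (p - 1) \<le> x"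
      by (auto simp: alphabet_def inner_def)
    then show ?thesis using assms(2,3) by auto
  qed
  then show ?thesis unfolding rank_def by (intro arg_cong[of _ _ card]) auto
qed

text \<open>Below and above the four letters only the other letters and the number of middle letters count;
the pattern matters at the three thresholds in between.\<close>

lemma dominates_iff:
  assumes R: "R \<subseteq> alphabet (Suc p)" and L: "L \<subseteq> alphabet (Suc p)" and p: "p > 0"
  shows "dominates d R L \<longleftrightarrow>
    (\<forall>c. c \<le> Unbarred p \<longrightarrow> rank c (L - inner p) \<le> d + rank c (R - inner p)) \<and>
    (\<forall>c. Barred p < c \<longrightarrow> rank c (L - inner p) + bits_size (bits p L)
        \<le> d + rank c (R - inner p) + bits_size (bits p R)) \<and>
    bits_dominate (d + rank (Unbarred p) (R - inner p) - rank (Unbarred p) (L - inner p)) (bits p R) (bits p L)"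
    (is "_ \<longleftrightarrow> ?low \<and> ?high \<and> ?mid")
proof -
  have fin: "finite R" "finite L" using R L finite_alphabet finite_subset by blast+
  let ?n = "\<lambda>X. rank (Unbarred p) (X - inner p)"
  have low: "rank c X = rank c (X - inner p)" if "finite X" "c \<le> Unbarred p" for X c
    using that by (cases c) (simp_all add: rank_split[of X _ p])
  have high: "rank c X = rank c (X - inner p) + bits_size (bits p X)" if "finite X" "Barred p < c" for X c
    using that by (cases c) (simp_all add: rank_split[of X _ p] bits_def)
  have low_iff: "?low \<longleftrightarrow> (\<forall>c. c \<le> Unbarred p \<longrightarrow> rank c L \<le> d + rank c R)"
    by (simp add: low[OF fin(1)] low[OF fin(2)])
  have high_iff: "?high \<longleftrightarrow> (\<forall>c. Barred p < c \<longrightarrow> rank c L \<le> d + rank c R)"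
    by (simp add: high[OF fin(1)] high[OF fin(2)] add.assoc)
  have m1: "rank c X = ?n X + of_bool (Unbarred p \<in> X)"
    if "X \<subseteq> alphabet (Suc p)" "finite X" "Unbarred p < c" "c \<le> Unbarred (Suc p)" for X c
  proof -
    have "c \<le> Barred (p - 1)" using that(4) by (cases c) auto
    then show ?thesis using that p rank_outer[OF that(1), of c] by (cases c) (auto simp: rank_split[of X _ p])
  qed
  have m2: "rank c X = ?n X + of_bool (Unbarred p \<in> X) + of_bool (Unbarred (Suc p) \<in> X)"
    if "X \<subseteq> alphabet (Suc p)" "finite X" "Unbarred (Suc p) < c" "c \<le> Barred (Suc p)" for X c
  proof -
    have "Unbarred p \<le> c" "c \<le> Barred (p - 1)" using that by (cases c; auto)+
    then show ?thesis using that p rank_outer[OF that(1), of c] by (cases c) (auto simp: rank_split[of X _ p])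
  qed
  have m3: "rank c X = ?n X + of_bool (Unbarred p \<in> X) + of_bool (Unbarred (Suc p) \<in> X) + of_bool (Barred (Suc p) \<in> X)"
    if "X \<subseteq> alphabet (Suc p)" "finite X" "Barred (Suc p) < c" "c \<le> Barred p" for X c
  proof -
    have "Unbarred p \<le> c" "c \<le> Barred (p - 1)" using that by (cases c; auto)+
    then show ?thesis using that p rank_outer[OF that(1), of c] by (cases c) (auto simp: rank_split[of X _ p])
  qed
  show ?thesis
  proof
    assume dom: "dominates d R L"
    then have le: "rank c L \<le> d + rank c R" for c by (simp add: dominates_def)
    have "?n L \<le> d + ?n R" using le[of "Unbarred p"] by (simp add: low[OF fin(1)] low[OF fin(2)])
    moreover have "?n L + of_bool (Unbarred p \<in> L) \<le> d + ?n R + of_bool (Unbarred p \<in> R)"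
      "?n L + of_bool (Unbarred p \<in> L) + of_bool (Unbarred (Suc p) \<in> L)
        \<le> d + ?n R + of_bool (Unbarred p \<in> R) + of_bool (Unbarred (Suc p) \<in> R)"
      "?n L + of_bool (Unbarred p \<in> L) + of_bool (Unbarred (Suc p) \<in> L) + of_bool (Barred (Suc p) \<in> L)
        \<le> d + ?n R + of_bool (Unbarred p \<in> R) + of_bool (Unbarred (Suc p) \<in> R) + of_bool (Barred (Suc p) \<in> R)"
      using le[of "Unbarred (Suc p)"] m1[OF R fin(1)] m1[OF L fin(2)] le[of "Barred (Suc p)"] m2[OF R fin(1)] m2[OF L fin(2)]
        le[of "Barred p"] m3[OF R fin(1)] m3[OF L fin(2)] by simp_all
    ultimately have ?mid
      unfolding bits_def bits_dominate.simps by linarith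
    then show "?low \<and> ?high \<and> ?mid" using le low_iff high_iff by blast
  next
    assume *: "?low \<and> ?high \<and> ?mid"
    then have n: "?n L \<le> d + ?n R" and mid: ?mid by blast+
    have "rank c L \<le> d + rank c R" for c
    proof -
      consider "c \<le> Unbarred p" | "Unbarred p < c" "c \<le> Unbarred (Suc p)"
        | "Unbarred (Suc p) < c" "c \<le> Barred (Suc p)" | "Barred (Suc p) < c" "c \<le> Barred p" | "Barred p < c"
        by (metis not_le)
      then show ?thesis
      proof cases
        case 1
        then show ?thesis using * low_iff by blast
      next
        case 5
        then show ?thesis using * high_iff by blast
      next
        case 2
        then show ?thesis
          using mid n unfolding m1[OF R fin(1) 2] m1[OF L fin(2) 2] bits_def bits_dominate.simps by linarith
      next
        case 3
        then show ?thesis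
          using mid n unfolding m2[OF R fin(1) 3] m2[OF L fin(2) 3] bits_def bits_dominate.simps by linarith
      next
        case 4
        then show ?thesis
          using mid n unfolding m3[OF R fin(1) 4] m3[OF L fin(2) 4] bits_def bits_dominate.simps by linarith
      qed
    qed
    then show "dominates d R L" by (simp add: dominates_def)
  qed
qed

section \<open>Locality of the splitting\<close>

text \<open>The case in which \<open>m - 1\<close> is chosen for the double letter \<open>m\<close>.\<close>

fun bits_absorbed :: "bits \<Rightarrow> bool" where
  "bits_absorbed (a, b, b', a') \<longleftrightarrow> b \<and> b' \<and> \<not> a \<and> \<not> a'"

text \<open>The choice of letters below \<open>p\<close>, described by the letters \<open>Y\<close> outside the four and the number
\<open>k\<close> of double letters among \<open>p\<close> and \<open>Suc p\<close> that still wait for a letter.  For the letters below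
\<open>p\<close> it does not matter which of the two is waiting, so each is represented by \<open>p\<close>.\<close>

definition core_greedy :: "nat \<Rightarrow> nat \<Rightarrow> letter set \<Rightarrow> nat list \<Rightarrow> bool" where
  "core_greedy p k Y us \<longleftrightarrow>
     greedy {t \<in> {1..<p}. Unbarred t \<notin> Y \<and> Barred t \<notin> Y} p (replicate k p @ descending (doubles Y)) us"

lemma core_greedy_unique: "core_greedy p k Y us \<Longrightarrow> core_greedy p k Y vs \<Longrightarrow> us = vs"
  unfolding core_greedy_def by (rule greedy_unique)

lemma core_greedy_bounds: "core_greedy p k Y us \<Longrightarrow> set us \<subseteq> {1..<p}"
  unfolding core_greedy_def using greedy_bounds by fastforce

lemma descending_insert:
  assumes "finite A" "\<forall>a\<in>A. a < z"
  shows "descending (insert z A) = z # descending A"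
proof -
  have "z \<notin> A" using assms by blast
  then have "sorted_list_of_set (insert z A) = insort z (sorted_list_of_set A)"
    using assms(1) by simp
  also have "\<dots> = sorted_list_of_set A @ [z]"
    using assms by (intro sorted_insort_is_snoc) (auto intro: less_imp_le)
  finally show ?thesis by (simp add: descending_def)
qed

text \<open>The splitting depends on the pattern of the four letters only through \<open>bits_need\<close>, apart from a
possible first choice \<open>p\<close>.  This is what makes the operators compatible with \<open>rC\<close> and \<open>lC\<close>: they
preserve \<open>bits_need\<close>.\<close>

lemma greedy_core:
  assumes X: "X \<subseteq> alphabet (Suc p)" and p: "p > 0"
  shows "greedy (free_letters (Suc p) X) (Suc (Suc p)) (descending (doubles X)) ts \<longleftrightarrow>
    (if bits_absorbed (bits p X)
     then \<exists>us. ts = p # us \<and> core_greedy p (bits_need (bits p X)) (X - inner p) us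
     else core_greedy p (bits_need (bits p X)) (X - inner p) ts)"
proof -
  let ?Fr = "free_letters (Suc p) X" and ?D = "doubles (X - inner p)"
  have fin: "finite ?D" using X finite_doubles finite_subset[OF _ finite_alphabet] by blast
  have D: "\<forall>z\<in>?D. z < p"
    using X by (force simp: doubles_def alphabet_def inner_def)
  have Fr: "{t \<in> ?Fr. t < p} = {t \<in> {1..<p}. Unbarred t \<notin> X - inner p \<and> Barred t \<notin> X - inner p}"
    by (auto simp: free_letters_def inner_def)
  have core: "core_greedy p k (X - inner p) us = greedy {t \<in> ?Fr. t < p} p (replicate k p @ descending ?D) us" for k us
    by (simp only: core_greedy_def Fr)
  have Dset: "\<forall>z\<in>set (descending ?D). z < p" using D fin by (simp add: descending_def)
  have dbl: "doubles X = (if Unbarred (Suc p) \<in> X \<and> Barred (Suc p) \<in> X then {Suc p} else {}) \<union>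
      ((if Unbarred p \<in> X \<and> Barred p \<in> X then {p} else {}) \<union> ?D)"
    by (auto simp: doubles_def inner_def)
  have d1: "descending (insert p ?D) = p # descending ?D" using fin D by (intro descending_insert) auto
  have d2: "descending (insert (Suc p) ?D) = Suc p # descending ?D" using fin D by (intro descending_insert) auto
  have d3: "descending (insert (Suc p) (insert p ?D)) = Suc p # p # descending ?D"
    using fin D by (subst descending_insert) (auto simp: d1)
  show ?thesis
  proof (cases "Unbarred (Suc p) \<in> X \<and> Barred (Suc p) \<in> X")
    case bb: True
    show ?thesis
    proof (cases "Unbarred p \<in> X \<or> Barred p \<in> X")
      case True
      then have nf: "p \<notin> ?Fr" by (auto simp: free_letters_def)
      have cap: "greedy ?Fr (Suc (Suc p)) (Suc p # zs) ts = greedy {t \<in> ?Fr. t < p} p (p # zs) ts" for zs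
        using nf by (intro greedy_cap) (auto simp: less_Suc_eq)
      show ?thesis
        using True bb by (auto simp: bits_def core dbl d2 d3 cap)
    next
      case False
      then have pf: "p \<in> ?Fr" using p by (simp add: free_letters_def)
      have "greedy ?Fr (Suc (Suc p)) (Suc p # descending ?D) ts \<longleftrightarrow>
          (\<exists>us. ts = p # us \<and> greedy ?Fr p (descending ?D) us)"
      proof (cases ts)
        case (Cons t us)
        have "t \<in> ?Fr \<and> t < Suc p \<and> t < Suc (Suc p) \<and> (\<forall>x\<in>?Fr. x < Suc p \<and> x < Suc (Suc p) \<longrightarrow> x \<le> t) \<longleftrightarrow> t = p"
          using pf by fastforce
        then show ?thesis unfolding Cons greedy.simps by blast
      qed simp
      also have "\<dots> = (\<exists>us. ts = p # us \<and> core_greedy p 0 (X - inner p) us)"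
        using greedy_restrict[of p p ?Fr] by (simp add: core)
      finally show ?thesis using False bb by (simp add: bits_def dbl d2)
    qed
  next
    case nbb: False
    show ?thesis
    proof (cases "Unbarred p \<in> X \<and> Barred p \<in> X")
      case True
      have "greedy ?Fr (Suc (Suc p)) (p # descending ?D) ts = greedy {t \<in> ?Fr. t < p} p (p # descending ?D) ts"
        by (intro greedy_cap) auto
      then show ?thesis using True nbb by (auto simp: bits_def core dbl d1)
    next
      case False
      have "greedy ?Fr (Suc (Suc p)) (descending ?D) ts = greedy {t \<in> ?Fr. t < p} p (descending ?D) ts"
        using Dset by (intro greedy_below) auto
      then show ?thesis using False nbb by (auto simp: bits_def core dbl)
    qed
  qed
qed

lemma admissible_set_core:
  assumes "p > 0"
  shows "admissible_set (Suc p) X \<longleftrightarrow>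
    X \<subseteq> alphabet (Suc p) \<and> (\<exists>us. core_greedy p (bits_need (bits p X)) (X - inner p) us)"
proof (cases "X \<subseteq> alphabet (Suc p)")
  case True
  then show ?thesis unfolding admissible_set_def greedy_core[OF True assms]
    by (cases "bits_absorbed (bits p X)") simp_all
qed (simp add: admissible_set_def)

definition core_splitting :: "nat \<Rightarrow> nat \<Rightarrow> letter set \<Rightarrow> nat list" where
  "core_splitting p k Y = (THE us. core_greedy p k Y us)"

lemma splitting_core:
  assumes X: "admissible_set (Suc p) X" and p: "p > 0"
  defines "k \<equiv> bits_need (bits p X)"
  shows "set (splitting (Suc p) X) =
      {t. bits_absorbed (bits p X) \<and> t = p} \<union> set (core_splitting p k (X - inner p))"
    and "set (core_splitting p k (X - inner p)) \<subseteq> {1..<p}"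
proof -
  obtain us where us: "core_greedy p k (X - inner p) us"
    using X p by (auto simp: admissible_set_core k_def)
  have core: "core_splitting p k (X - inner p) = us"
    unfolding core_splitting_def using us by (rule the_equality) (metis core_greedy_unique us)
  then show "set (core_splitting p k (X - inner p)) \<subseteq> {1..<p}"
    using core_greedy_bounds[OF us] by simp
  have gr: "greedy (free_letters (Suc p) X) (Suc (Suc p)) (descending (doubles X)) (splitting (Suc p) X)"
    by (rule greedy_splitting[OF X])
  have "X \<subseteq> alphabet (Suc p)" using X by (simp add: admissible_set_def)
  note gr' = gr[unfolded greedy_core[OF this p], folded k_def]
  show "set (splitting (Suc p) X) = {t. bits_absorbed (bits p X) \<and> t = p} \<union> set (core_splitting p k (X - inner p))"
  proof (cases "bits_absorbed (bits p X)")
    case True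
    then obtain vs where "splitting (Suc p) X = p # vs" "core_greedy p k (X - inner p) vs"
      using gr' by auto
    then show ?thesis using True core_greedy_unique[OF us] core by auto
  next
    case False
    then have "splitting (Suc p) X = us" using gr' core_greedy_unique[OF us] by simp
    then show ?thesis using False core by simp
  qed
qed

lemma mem_right_set:
  "Unbarred t \<in> right_set m X \<longleftrightarrow> Unbarred t \<in> X"
  "Barred t \<in> right_set m X \<longleftrightarrow> Barred t \<in> X \<and> Unbarred t \<notin> X \<or> t \<in> set (splitting m X)"
  by (auto simp: right_set_def doubles_def)

lemma mem_left_set:
  "Unbarred t \<in> left_set m X \<longleftrightarrow> Unbarred t \<in> X \<and> Barred t \<notin> X \<or> t \<in> set (splitting m X)"
  "Barred t \<in> left_set m X \<longleftrightarrow> Barred t \<in> X"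
  by (auto simp: left_set_def doubles_def)

lemma
  assumes X: "admissible_set (Suc p) X" and p: "p > 0"
  defines "k \<equiv> bits_need (bits p X)"
  shows bits_right_set: "bits p (right_set (Suc p) X) = bits_right (bits p X)"
    and bits_left_set: "bits p (left_set (Suc p) X) = bits_left (bits p X)"
    and outer_right_set: "right_set (Suc p) X - inner p =
      (X - inner p - Barred ` doubles (X - inner p)) \<union> Barred ` set (core_splitting p k (X - inner p))"
    and outer_left_set: "left_set (Suc p) X - inner p =
      (X - inner p - Unbarred ` doubles (X - inner p)) \<union> Unbarred ` set (core_splitting p k (X - inner p))"
proof -
  let ?us = "set (core_splitting p k (X - inner p))"
  note spl = splitting_core[OF X p, folded k_def]
  have us: "p \<notin> ?us" "Suc p \<notin> ?us" using spl(2) by auto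
  then have mem: "p \<in> set (splitting (Suc p) X) \<longleftrightarrow> bits_absorbed (bits p X)"
    "Suc p \<notin> set (splitting (Suc p) X)"
    "\<And>t. t \<noteq> p \<Longrightarrow> t \<in> set (splitting (Suc p) X) \<longleftrightarrow> t \<in> ?us"
    unfolding spl(1) by simp_all
  show "bits p (right_set (Suc p) X) = bits_right (bits p X)"
    by (auto simp: bits_def mem_right_set mem)
  show "bits p (left_set (Suc p) X) = bits_left (bits p X)"
    by (auto simp: bits_def mem_left_set mem)
  show "right_set (Suc p) X - inner p =
      (X - inner p - Barred ` doubles (X - inner p)) \<union> Barred ` ?us" (is "?l = ?r")
  proof (rule Set.set_eqI)
    fix x show "x \<in> ?l \<longleftrightarrow> x \<in> ?r"
    proof (cases x)
      case (Barred t)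
      then show ?thesis using us mem(3)[of t]
        by (cases "t = p \<or> t = Suc p") (auto simp: mem_right_set inner_def doubles_def)
    qed (auto simp: mem_right_set inner_def)
  qed
  show "left_set (Suc p) X - inner p =
      (X - inner p - Unbarred ` doubles (X - inner p)) \<union> Unbarred ` ?us" (is "?l = ?r")
  proof (rule Set.set_eqI)
    fix x show "x \<in> ?l \<longleftrightarrow> x \<in> ?r"
    proof (cases x)
      case (Unbarred t)
      then show ?thesis using us mem(3)[of t]
        by (cases "t = p \<or> t = Suc p") (auto simp: mem_left_set inner_def doubles_def)
    qed (auto simp: mem_left_set inner_def)
  qed
qed

definition column_phi :: "nat \<Rightarrow> letter set \<Rightarrow> nat" where "column_phi p X = bits_phi (bits p X)"
definition column_eps :: "nat \<Rightarrow> letter set \<Rightarrow> nat" where "column_eps p X = bits_eps (bits p X)"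
definition column_F :: "nat \<Rightarrow> letter set \<Rightarrow> letter set" where "column_F p X = with_bits p (bits_F (bits p X)) X"
definition column_E :: "nat \<Rightarrow> letter set \<Rightarrow> letter set" where "column_E p X = with_bits p (bits_E (bits p X)) X"

lemma bits_column [simp]:
  "bits p (column_F p X) = bits_F (bits p X)" "bits p (column_E p X) = bits_E (bits p X)"
  "column_F p X - inner p = X - inner p" "column_E p X - inner p = X - inner p"
  by (simp_all add: column_F_def column_E_def)

lemma column_crystal:
  assumes p: "p > 0"
  shows "string_crystal {X. admissible_set (Suc p) X} (column_eps p) (column_phi p) (column_F p) (column_E p)"
proof
  fix X assume X: "X \<in> {X. admissible_set (Suc p) X}"
  then have X': "X \<subseteq> alphabet (Suc p)" by (simp add: admissible_set_def)
  have F: "column_F p X \<subseteq> alphabet (Suc p)" "column_E p X \<subseteq> alphabet (Suc p)"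
    using X' p by (simp_all add: column_F_def column_E_def with_bits_alphabet)
  {
    assume pos: "column_phi p X > 0"
    note bits_F = bits_F[OF pos[unfolded column_phi_def]]
    have "column_E p (column_F p X) = X" by (rule bits_outer_eqI[of p]) (simp_all add: bits_F)
    then show "column_F p X \<in> {X. admissible_set (Suc p) X} \<and>
        column_eps p (column_F p X) = Suc (column_eps p X) \<and>
        Suc (column_phi p (column_F p X)) = column_phi p X \<and> column_E p (column_F p X) = X"
      using X F p by (simp add: admissible_set_core bits_F column_phi_def column_eps_def)
  next
    assume pos: "column_eps p X > 0"
    note bits_E = bits_E[OF pos[unfolded column_eps_def]] bits_E_more[OF pos[unfolded column_eps_def]]
    have "column_F p (column_E p X) = X" by (rule bits_outer_eqI[of p]) (simp_all add: bits_E)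
    then show "column_E p X \<in> {X. admissible_set (Suc p) X} \<and>
        Suc (column_eps p (column_E p X)) = column_eps p X \<and>
        column_phi p (column_E p X) = Suc (column_phi p X) \<and> column_F p (column_E p X) = X"
      using X F p by (simp add: admissible_set_core bits_E column_phi_def column_eps_def)
  }
qed

lemma card_inner_outer:
  assumes "finite X"
  shows "card X = card (X - inner p) + bits_size (bits p X)"
proof -
  have "card X = card (X - inner p) + card {x \<in> inner p. x \<in> X}"
    using assms by (subst card_Un_disjoint[symmetric]) (auto intro!: arg_cong[of _ _ card])
  then show ?thesis by (simp add: card_filter_inner bits_def)
qed

text \<open>Changing the patterns while keeping \<open>bits_need\<close> and the sizes leaves the comparison of adjacent
columns untouched except for the finite condition \<open>bits_dominate\<close>.\<close>

lemma dominates_change: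
  assumes p: "p > 0"
    and C: "admissible_set (Suc p) C" "admissible_set (Suc p) C'" "C' - inner p = C - inner p"
      "bits_need (bits p C') = bits_need (bits p C)"
      "bits_size (bits_right (bits p C')) = bits_size (bits_right (bits p C))"
    and D: "admissible_set (Suc p) D" "admissible_set (Suc p) D'" "D' - inner p = D - inner p"
      "bits_need (bits p D') = bits_need (bits p D)"
      "bits_size (bits_left (bits p D')) = bits_size (bits_left (bits p D))"
    and dom: "dominates d (right_set (Suc p) C) (left_set (Suc p) D)"
    and mid: "\<And>k. bits_size (bits_left (bits p D)) \<le> k + bits_size (bits_right (bits p C)) \<Longrightarrow>
      bits_dominate k (bits_right (bits p C)) (bits_left (bits p D)) \<Longrightarrow>
      bits_dominate k (bits_right (bits p C')) (bits_left (bits p D'))"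
  shows "dominates d (right_set (Suc p) C') (left_set (Suc p) D')"
proof -
  let ?R = "right_set (Suc p) C" and ?R' = "right_set (Suc p) C'"
  let ?L = "left_set (Suc p) D" and ?L' = "left_set (Suc p) D'"
  have sub: "?R \<subseteq> alphabet (Suc p)" "?R' \<subseteq> alphabet (Suc p)" "?L \<subseteq> alphabet (Suc p)" "?L' \<subseteq> alphabet (Suc p)"
    using C(1,2) D(1,2) by (simp_all add: left_set_alphabet right_set_alphabet)
  have R: "?R' - inner p = ?R - inner p"
    using C p by (simp add: outer_right_set)
  have L: "?L' - inner p = ?L - inner p"
    using D p by (simp add: outer_left_set)
  let ?k = "d + rank (Unbarred p) (?R - inner p) - rank (Unbarred p) (?L - inner p)"
  have *: "(\<forall>c. c \<le> Unbarred p \<longrightarrow> rank c (?L - inner p) \<le> d + rank c (?R - inner p)) \<and>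
    (\<forall>c. Barred p < c \<longrightarrow> rank c (?L - inner p) + bits_size (bits p ?L)
        \<le> d + rank c (?R - inner p) + bits_size (bits p ?R)) \<and>
    bits_dominate ?k (bits p ?R) (bits p ?L)"
    using dom dominates_iff[OF sub(1) sub(3) p] by blast
  have "rank (Barred (p - 1)) (?L - inner p) + bits_size (bits p ?L)
        \<le> d + rank (Barred (p - 1)) (?R - inner p) + bits_size (bits p ?R)"
    using * p by simp
  then have "bits_size (bits p ?L) \<le> ?k + bits_size (bits p ?R)"
    using rank_outer[OF sub(1) _ _ p, of "Barred (p - 1)"] rank_outer[OF sub(3) _ _ p, of "Barred (p - 1)"]
    by simp
  then have "bits_dominate ?k (bits p ?R') (bits p ?L')"
    using mid * C(1,2) D(1,2) p by (simp add: bits_right_set bits_left_set)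
  moreover have "bits_size (bits p ?R') = bits_size (bits p ?R)" "bits_size (bits p ?L') = bits_size (bits p ?L)"
    using C D p by (simp_all add: bits_right_set bits_left_set)
  ultimately show ?thesis
    unfolding dominates_iff[OF sub(2) sub(4) p] R L using * by simp
qed

section \<open>Exchanging the last two coordinates of a weight\<close>

text \<open>The combinatorial content of a tableau with \<open>K\<close> columns: column \<open>j\<close> has \<open>h j\<close> boxes, and column
\<open>j + 1\<close> begins \<open>\<delta> j\<close> rows higher.\<close>

definition column_chains :: "nat \<Rightarrow> nat \<Rightarrow> (nat \<Rightarrow> nat) \<Rightarrow> (nat \<Rightarrow> nat) \<Rightarrow> letter set list set" where
  "column_chains m K \<delta> h = {cs. length cs = K \<and>
     (\<forall>j<K. admissible_set m (cs ! j) \<and> card (cs ! j) = h j) \<and>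
     (\<forall>j. Suc j < K \<longrightarrow> dominates (\<delta> j) (right_set m (cs ! j)) (left_set m (cs ! Suc j)))}"

definition balance :: "nat \<Rightarrow> letter set \<Rightarrow> int" where
  "balance i X = of_bool (Unbarred i \<in> X) - of_bool (Barred i \<in> X)"

definition chain_weight :: "nat \<Rightarrow> letter set list \<Rightarrow> int list" where
  "chain_weight m cs = map (\<lambda>i. \<Sum>X\<leftarrow>cs. balance i X) [1..<m + 1]"

lemma column_chains_eq:
  "column_chains m K \<delta> h = string_crystal.chains {X. admissible_set m X} K
     (\<lambda>j C D. dominates (\<delta> j) (right_set m C) (left_set m D)) (\<lambda>j X. card X = h j)"
proof -
  interpret string_crystal "{X. admissible_set m X}" "\<lambda>_. 0" "\<lambda>_. 0" id id
    by unfold_locales simp_all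
  show ?thesis by (fastforce simp: column_chains_def chains_def set_conv_nth)
qed

lemma column_phi_eps: "int (column_phi p X) - int (column_eps p X) = balance p X - balance (Suc p) X"
  by (auto simp: column_phi_def column_eps_def bits_def balance_def)

lemma balance_column_F:
  assumes "column_phi p X > 0" "i \<le> p"
  shows "(if i < p then balance i (column_F p X) else balance p (column_F p X) + balance (Suc p) (column_F p X))
       = (if i < p then balance i X else balance p X + balance (Suc p) X)"
proof (cases "i < p")
  case True
  then have "Unbarred i \<notin> inner p" "Barred i \<notin> inner p" by (auto simp: inner_def)
  then show ?thesis using True by (simp add: balance_def column_F_def with_bits_outside)
next
  case False
  have bal: "balance p Y + balance (Suc p) Y = (case bits p Y of (a, b, b', a') \<Rightarrow>
      of_bool a - of_bool a' + of_bool b - of_bool b')" for Y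
    by (simp add: balance_def bits_def)
  show ?thesis using assms(1) False
    by (auto simp: bal column_phi_def split: prod.splits if_splits)
qed

text \<open>Prescribing the last two coordinates is the same as prescribing their sum, which is constant along
strings, and their difference, which is the string weight.\<close>

lemma chain_weight_snoc2_iff:
  assumes "p > 0" "length u + 1 = p"
  shows "chain_weight (Suc p) cs = u @ [x, y] \<longleftrightarrow>
    (\<forall>i\<in>{1..p}. (\<Sum>X\<leftarrow>cs. if i < p then balance i X else balance p X + balance (Suc p) X)
        = (if i < p then u ! (i - 1) else x + y)) \<and>
    (\<Sum>X\<leftarrow>cs. int (column_phi p X) - int (column_eps p X)) = x - y"
    (is "_ \<longleftrightarrow> (\<forall>i\<in>{1..p}. ?A i) \<and> ?B")
proof -
  let ?b = "\<lambda>i. \<Sum>X\<leftarrow>cs. balance i X"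
  have "[1..<Suc p + 1] = [1..<p] @ [p, Suc p]" using assms by simp
  then have "chain_weight (Suc p) cs = map ?b [1..<p] @ [?b p, ?b (Suc p)]"
    unfolding chain_weight_def by (simp only: map_append list.map)
  then have "chain_weight (Suc p) cs = u @ [x, y] \<longleftrightarrow> map ?b [1..<p] = u \<and> ?b p = x \<and> ?b (Suc p) = y"
    using assms by simp
  also have "map ?b [1..<p] = u \<longleftrightarrow> (\<forall>i\<in>{1..<p}. ?b i = u ! (i - 1))"
  proof
    assume u: "map ?b [1..<p] = u"
    show "\<forall>i\<in>{1..<p}. ?b i = u ! (i - 1)" unfolding u[symmetric] by auto
  next
    assume "\<forall>i\<in>{1..<p}. ?b i = u ! (i - 1)"
    then show "map ?b [1..<p] = u" using assms by (intro nth_equalityI) auto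
  qed
  also have "(\<forall>i\<in>{1..<p}. ?b i = u ! (i - 1)) \<and> ?b p = x \<and> ?b (Suc p) = y \<longleftrightarrow>
      (\<forall>i\<in>{1..<p}. ?b i = u ! (i - 1)) \<and> ?b p + ?b (Suc p) = x + y \<and> ?b p - ?b (Suc p) = x - y"
    by auto
  also have "\<dots> \<longleftrightarrow> (\<forall>i\<in>{1..p}. ?A i) \<and> ?B"
  proof -
    have "{1..p} = insert p {1..<p}" using assms by auto
    moreover have "?A p \<longleftrightarrow> ?b p + ?b (Suc p) = x + y" by (simp add: sum_list_addf)
    moreover have "?B \<longleftrightarrow> ?b p - ?b (Suc p) = x - y" by (simp add: column_phi_eps sum_list_subtractf)
    moreover have "(\<forall>i\<in>{1..<p}. ?b i = u ! (i - 1)) \<longleftrightarrow> (\<forall>i\<in>{1..<p}. ?A i)" by auto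
    ultimately show ?thesis by (simp only: ball_simps) blast
  qed
  finally show ?thesis .
qed

theorem card_chains_swap:
  assumes u: "length u + 2 = m"
  shows "card {cs \<in> column_chains m K \<delta> h. chain_weight m cs = u @ [x, y]}
       = card {cs \<in> column_chains m K \<delta> h. chain_weight m cs = u @ [y, x]}"
proof -
  obtain p where m: "m = Suc p" and p: "p > 0" and up: "length u + 1 = p" using u by (cases m) auto
  let ?B = "{X. admissible_set (Suc p) X}"
  interpret string_crystal ?B "column_eps p" "column_phi p" "column_F p" "column_E p"
    by (rule column_crystal[OF p])
  let ?R = "\<lambda>j C D. dominates (\<delta> j) (right_set (Suc p) C) (left_set (Suc p) D)"
  let ?Q = "chains K ?R (\<lambda>j X. card X = h j)"
  have fin: "finite X" if "X \<in> ?B" for X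
    using that finite_subset[OF _ finite_alphabet] by (auto simp: admissible_set_def)
  have cF: "column_F p X \<in> ?B" "bits_need (bits p (column_F p X)) = bits_need (bits p X)"
    "bits_size (bits p (column_F p X)) = bits_size (bits p X)"
    "bits_size (bits_right (bits p (column_F p X))) = bits_size (bits_right (bits p X))"
    "bits_size (bits_left (bits p (column_F p X))) = bits_size (bits_left (bits p X))"
    if "X \<in> ?B" "column_phi p X > 0" for X
    using F[OF that] bits_F[of "bits p X"] that by (simp_all add: column_phi_def)
  have cE: "column_E p X \<in> ?B" "bits_need (bits p (column_E p X)) = bits_need (bits p X)"
    "bits_size (bits p (column_E p X)) = bits_size (bits p X)"
    "bits_size (bits_right (bits p (column_E p X))) = bits_size (bits_right (bits p X))"
    "bits_size (bits_left (bits p (column_E p X))) = bits_size (bits_left (bits p X))"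
    if "X \<in> ?B" "column_eps p X > 0" for X
    using E[OF that] bits_E_more[of "bits p X"] that by (simp_all add: column_eps_def)
  have closed_F: "list_F cs \<in> ?Q" if "cs \<in> ?Q" "list_phi cs > 0" for cs
  proof (rule list_F_chains[OF _ _ _ that])
    fix j X assume X: "X \<in> ?B" "card X = h j" "column_phi p X > 0"
    then show "card (column_F p X) = h j"
      using cF[of X] card_inner_outer[of X p] card_inner_outer[of "column_F p X" p] fin by simp
  next
    fix j C D assume *: "C \<in> ?B" "D \<in> ?B" "?R j C D" "column_eps p C < column_phi p D"
    then show "?R j C (column_F p D)"
      using cF[of D] by (intro dominates_change[OF p _ _ _ _ _ _ _ _ _ _ *(3)])
        (auto simp: column_phi_def column_eps_def intro: bits_F_right)
  next
    fix j C D assume *: "C \<in> ?B" "D \<in> ?B" "?R j C D" "column_phi p D \<le> column_eps p C" "column_phi p C > 0"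
    then show "?R j (column_F p C) D"
      using cF[of C] by (intro dominates_change[OF p _ _ _ _ _ _ _ _ _ _ *(3)])
        (auto simp: column_phi_def column_eps_def intro: bits_F_left)
  qed
  have closed_E: "list_E cs \<in> ?Q" if "cs \<in> ?Q" "list_eps cs > 0" for cs
  proof (rule list_E_chains[OF _ _ _ that])
    fix j X assume X: "X \<in> ?B" "card X = h j" "column_eps p X > 0"
    then show "card (column_E p X) = h j"
      using cE[of X] card_inner_outer[of X p] card_inner_outer[of "column_E p X" p] fin by simp
  next
    fix j C D assume *: "C \<in> ?B" "D \<in> ?B" "?R j C D" "column_eps p C \<le> column_phi p D" "column_eps p D > 0"
    then show "?R j C (column_E p D)"
      using cE[of D] by (intro dominates_change[OF p _ _ _ _ _ _ _ _ _ _ *(3)])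
        (auto simp: column_phi_def column_eps_def intro: bits_E_right)
  next
    fix j C D assume *: "C \<in> ?B" "D \<in> ?B" "?R j C D" "column_phi p D < column_eps p C"
    then show "?R j (column_E p C) D"
      using cE[of C] by (intro dominates_change[OF p _ _ _ _ _ _ _ _ _ _ *(3)])
        (auto simp: column_phi_def column_eps_def intro: bits_E_left)
  qed
  \<comment> \<open>Constant along strings: the coordinates before the last two, and the sum of the last two.\<close>
  let ?h = "\<lambda>X i. if i < p then balance i X else if i = p then balance p X + balance (Suc p) X else 0"
  have h: "?h (column_F p X) = ?h X" if "X \<in> ?B" "column_phi p X > 0" for X
  proof
    fix i show "?h (column_F p X) i = ?h X i"
      using balance_column_F[OF that(2), of i] by (cases "i \<le> p") (auto simp: not_le)
  qed
  have wt: "{cs \<in> ?Q. chain_weight (Suc p) cs = u @ [a, b]} =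
    {cs \<in> ?Q. (\<forall>i\<in>{1..p}. (\<Sum>X\<leftarrow>cs. ?h X i) = (if i < p then u ! (i - 1) else a + b)) \<and>
      (\<Sum>X\<leftarrow>cs. int (column_phi p X) - int (column_eps p X)) = a - b}" for a b
    unfolding chain_weight_snoc2_iff[OF p up]
    by (rule Collect_cong) (intro conj_cong refl ball_cong, auto)
  have "card {cs \<in> ?Q. chain_weight (Suc p) cs = u @ [x, y]} = card {cs \<in> ?Q. chain_weight (Suc p) cs = u @ [y, x]}"
    unfolding wt
    using card_weight_symmetric[of ?Q ?h "{1..p}" "\<lambda>i. if i < p then u ! (i - 1) else x + y" "x - y", OF _ closed_F closed_E h]
    by (simp add: chains_def add.commute[of y x])
  then show ?thesis by (simp add: column_chains_eq m)
qed

section \<open>Columns as lists\<close>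

lemma double_letters_eq: "double_letters C = descending (doubles (set C))"
  by (simp add: double_letters_def descending_def doubles_def)

lemma greedy_iff_nth:
  "greedy A b zs ts \<longleftrightarrow> length ts = length zs \<and>
     (\<forall>i<length ts. ts ! i \<in> A \<and> ts ! i < zs ! i \<and> ts ! i < (b # ts) ! i \<and>
        (\<forall>t\<in>A. t < zs ! i \<and> t < (b # ts) ! i \<longrightarrow> t \<le> ts ! i))"
proof (induction A b zs ts rule: greedy.induct)
  case (3 A b z zs t ts)
  then show ?case by (simp add: All_less_Suc2) blast
qed auto

lemma split_letters_iff_greedy:
  "split_letters m C ts \<longleftrightarrow>
     greedy (free_letters m (set C)) (Suc m) (descending (doubles (set C))) ts"
proof -
  have "split_candidates m C ts i = {t \<in> free_letters m (set C).
      t < descending (doubles (set C)) ! i \<and> t < (Suc m # ts) ! i}" for i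
    by (cases i) (auto simp: split_candidates_def free_letters_def double_letters_eq)
  then show ?thesis
    by (auto simp: split_letters_def greedy_iff_nth double_letters_eq)
qed

lemma admissible_iff: "admissible m C \<longleftrightarrow> sorted_wrt (<) C \<and> admissible_set m (set C)"
  by (simp add: admissible_def admissible_set_def split_letters_iff_greedy)

lemma strict_sorted_distinct: "sorted_wrt (<) (C :: 'a::linorder list) \<Longrightarrow> distinct C"
  using strict_sorted_iff by blast

text \<open>The function \<open>split_map\<close> is written with an association list that pairs the double letters with
the chosen letters; here it is related to the set of chosen letters.\<close>

lemma split_map_props:
  assumes "admissible_set m (set C)"
  shows "split_map m C ` doubles (set C) = set (splitting m (set C))"
    and "split_map m C z \<le> z"
    and "z \<notin> doubles (set C) \<Longrightarrow> split_map m C z = z"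
proof -
  let ?zs = "descending (doubles (set C))" and ?ts = "splitting m (set C)"
  have map: "split_map m C z = (case map_of (zip ?zs ?ts) z of Some t \<Rightarrow> t | None \<Rightarrow> z)" for z
    by (simp add: split_map_def double_letters_eq split_letters_iff_greedy splitting_def)
  have zs: "set ?zs = doubles (set C)" "distinct ?zs"
    by (simp_all add: descending_def finite_doubles)
  have g: "greedy (free_letters m (set C)) (Suc m) ?zs ?ts" by (rule greedy_splitting[OF assms])
  have len: "length ?zs = length ?ts" using greedy_length[OF g] by simp
  have nth: "split_map m C (?zs ! i) = ?ts ! i" if "i < length ?zs" for i
  proof -
    have "map_of (zip ?zs ?ts) (?zs ! i) = Some (?ts ! i)"
      using that len zs(2) by (intro map_of_zip_nth) auto
    then show ?thesis by (simp add: map)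
  qed
  show "split_map m C ` doubles (set C) = set ?ts"
  proof -
    have "map (split_map m C) ?zs = ?ts" by (rule nth_equalityI) (simp_all add: len nth)
    then show ?thesis by (metis zs(1) set_map)
  qed
  show fixed: "split_map m C z = z" if "z \<notin> doubles (set C)"
  proof -
    have "map_of (zip ?zs ?ts) z = None" using that zs(1) len by simp
    then show ?thesis by (simp only: map option.case)
  qed
  show "split_map m C z \<le> z"
  proof (cases "z \<in> doubles (set C)")
    case True
    then obtain i where i: "i < length ?zs" "z = ?zs ! i" using zs(1) by (metis in_set_conv_nth)
    then show ?thesis using nth greedy_bounds[OF g] len by (auto intro: less_imp_le)
  qed (simp add: fixed)
qed

text \<open>The letterwise maps from \<open>C\<close> onto \<open>lC\<close> and \<open>rC\<close>.  In the order of the alphabet the first lowers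
letters and the second raises them, since the order is reversed on barred letters.\<close>

definition lower_unbarred :: "nat \<Rightarrow> letter list \<Rightarrow> letter \<Rightarrow> letter" where
  "lower_unbarred m C x = (case x of Unbarred z \<Rightarrow> Unbarred (split_map m C z) | Barred z \<Rightarrow> Barred z)"

definition raise_barred :: "nat \<Rightarrow> letter list \<Rightarrow> letter \<Rightarrow> letter" where
  "raise_barred m C x = (case x of Unbarred z \<Rightarrow> Unbarred z | Barred z \<Rightarrow> Barred (split_map m C z))"

lemma
  assumes "admissible_set m (set C)"
  shows image_lower_unbarred: "lower_unbarred m C ` set C = left_set m (set C)"
    and image_raise_barred: "raise_barred m C ` set C = right_set m (set C)"
    and lower_unbarred_le: "lower_unbarred m C x \<le> x"
    and raise_barred_ge: "x \<le> raise_barred m C x"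
proof -
  note sm = split_map_props[OF assms]
  have in_spl: "split_map m C z \<in> set (splitting m (set C))" if "z \<in> doubles (set C)" for z
    using that sm(1) by blast
  show "lower_unbarred m C ` set C = left_set m (set C)"
  proof (intro equalityI subsetI)
    fix y assume "y \<in> lower_unbarred m C ` set C"
    then obtain x where x: "x \<in> set C" "y = lower_unbarred m C x" by blast
    show "y \<in> left_set m (set C)"
    proof (cases x)
      case (Unbarred z)
      then show ?thesis using x in_spl[of z] sm(3)[of z]
        by (cases "z \<in> doubles (set C)") (auto simp: lower_unbarred_def left_set_def)
    next
      case (Barred z)
      then show ?thesis using x by (auto simp: lower_unbarred_def left_set_def)
    qed
  next
    fix y assume y: "y \<in> left_set m (set C)"
    show "y \<in> lower_unbarred m C ` set C"
    proof (cases y)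
      case (Unbarred t)
      consider "Unbarred t \<in> set C" "t \<notin> doubles (set C)" | "t \<in> set (splitting m (set C))"
        using y Unbarred by (auto simp: left_set_def)
      then show ?thesis
      proof cases
        case 1
        then have "y = lower_unbarred m C y" using Unbarred sm(3) by (simp add: lower_unbarred_def)
        then show ?thesis using 1 Unbarred by blast
      next
        case 2
        then obtain z where "z \<in> doubles (set C)" "t = split_map m C z" using sm(1) by blast
        then have "y = lower_unbarred m C (Unbarred z)" "Unbarred z \<in> set C"
          using Unbarred by (simp_all add: lower_unbarred_def doubles_def)
        then show ?thesis by blast
      qed
    next
      case (Barred t)
      then have "y \<in> set C" "y = lower_unbarred m C y" using y by (auto simp: left_set_def lower_unbarred_def)
      then show ?thesis by blast
    qed
  qed
  show "raise_barred m C ` set C = right_set m (set C)"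
  proof (intro equalityI subsetI)
    fix y assume "y \<in> raise_barred m C ` set C"
    then obtain x where x: "x \<in> set C" "y = raise_barred m C x" by blast
    show "y \<in> right_set m (set C)"
    proof (cases x)
      case (Barred z)
      then show ?thesis using x in_spl[of z] sm(3)[of z]
        by (cases "z \<in> doubles (set C)") (auto simp: raise_barred_def right_set_def)
    next
      case (Unbarred z)
      then show ?thesis using x by (auto simp: raise_barred_def right_set_def)
    qed
  next
    fix y assume y: "y \<in> right_set m (set C)"
    show "y \<in> raise_barred m C ` set C"
    proof (cases y)
      case (Barred t)
      consider "Barred t \<in> set C" "t \<notin> doubles (set C)" | "t \<in> set (splitting m (set C))"
        using y Barred by (auto simp: right_set_def)
      then show ?thesis
      proof cases
        case 1
        then have "y = raise_barred m C y" using Barred sm(3) by (simp add: raise_barred_def)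
        then show ?thesis using 1 Barred by blast
      next
        case 2
        then obtain z where "z \<in> doubles (set C)" "t = split_map m C z" using sm(1) by blast
        then have "y = raise_barred m C (Barred z)" "Barred z \<in> set C"
          using Barred by (simp_all add: raise_barred_def doubles_def)
        then show ?thesis by blast
      qed
    next
      case (Unbarred t)
      then have "y \<in> set C" "y = raise_barred m C y" using y by (auto simp: right_set_def raise_barred_def)
      then show ?thesis by blast
    qed
  qed
  show "lower_unbarred m C x \<le> x" "x \<le> raise_barred m C x"
    using sm(2) by (cases x; simp add: lower_unbarred_def raise_barred_def)+
qed

lemma
  assumes "admissible_set m X"
  shows card_left_set: "card (left_set m X) = card X"
    and card_right_set: "card (right_set m X) = card X"
proof -
  have fin: "finite X" using assms finite_subset[OF _ finite_alphabet] by (auto simp: admissible_set_def)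
  then have finD: "finite (doubles X)" by (rule finite_doubles)
  note spl = splitting_free[OF assms] distinct_card[OF distinct_splitting[OF assms]] length_splitting[OF assms]
  have le: "card (doubles X) \<le> card X" "Unbarred ` doubles X \<subseteq> X" "Barred ` doubles X \<subseteq> X"
    using card_inj_on_le[of Unbarred "doubles X" X] fin by (auto simp: doubles_def inj_on_def)
  have img: "card (Unbarred ` A) = card A" "card (Barred ` A) = card A" for A
    by (simp_all add: card_image inj_on_def)
  have "card (left_set m X) = card (X - Unbarred ` doubles X) + card (Unbarred ` set (splitting m X))"
    unfolding left_set_def using fin spl(1) by (intro card_Un_disjoint) (auto simp: free_letters_def)
  then show "card (left_set m X) = card X"
    using spl le finD by (simp add: card_Diff_subset img)
  have "card (right_set m X) = card (X - Barred ` doubles X) + card (Barred ` set (splitting m X))"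
    unfolding right_set_def using fin spl(1) by (intro card_Un_disjoint) (auto simp: free_letters_def)
  then show "card (right_set m X) = card X"
    using spl le finD by (simp add: card_Diff_subset img)
qed

lemma sort_map_eq:
  assumes "distinct C" "card (f ` set C) = card (set C)"
  shows "sort (map f C) = sorted_list_of_set (f ` set C)"
proof -
  have "distinct (map f C)" using assms by (intro card_distinct) (simp add: distinct_card)
  then show ?thesis using sorted_list_of_set_sort_remdups[of "map f C"] by (simp add: distinct_remdups_id)
qed

lemma
  assumes "admissible m C"
  shows left_column_eq: "left_column m C = sorted_list_of_set (left_set m (set C))"
    and right_column_eq: "right_column m C = sorted_list_of_set (right_set m (set C))"
    and rank_left_set: "rank c (set C) \<le> rank c (left_set m (set C))"
    and rank_right_set: "rank c (right_set m (set C)) \<le> rank c (set C)"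
proof -
  have C: "distinct C" "admissible_set m (set C)"
    using assms strict_sorted_distinct by (auto simp: admissible_iff)
  note im = image_lower_unbarred[OF C(2)] image_raise_barred[OF C(2)]
  note cards = card_left_set[OF C(2)] card_right_set[OF C(2)]
  show "left_column m C = sorted_list_of_set (left_set m (set C))"
    using sort_map_eq[OF C(1), of "lower_unbarred m C"] im cards
    by (simp add: left_column_def lower_unbarred_def[abs_def])
  show "right_column m C = sorted_list_of_set (right_set m (set C))"
    using sort_map_eq[OF C(1), of "raise_barred m C"] im cards
    by (simp add: right_column_def raise_barred_def[abs_def])
  have inj: "inj_on (lower_unbarred m C) (set C)"
    using im cards by (intro eq_card_imp_inj_on) auto
  have "finite (left_set m (set C))" by (simp flip: im)
  then show "rank c (set C) \<le> rank c (left_set m (set C))"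
    unfolding rank_def
    using inj im(1) lower_unbarred_le[OF C(2)]
    by (intro card_inj_on_le[of "lower_unbarred m C"]) (auto intro: inj_on_subset le_less_trans)
  have "{y \<in> right_set m (set C). y < c} \<subseteq> raise_barred m C ` {x \<in> set C. x < c}"
    using raise_barred_ge[OF C(2)] by (auto simp flip: im(2) intro: le_less_trans)
  then show "rank c (right_set m (set C)) \<le> rank c (set C)"
    unfolding rank_def by (intro surj_card_le) auto
qed

section \<open>Semistandard fillings by ranks\<close>

lemma nth_less_iff_rank:
  "sorted_wrt (<) xs \<Longrightarrow> k < length xs \<Longrightarrow> xs ! k < c \<longleftrightarrow> k < rank c (set xs)"
proof (induction xs arbitrary: k)
  case (Cons x xs)
  show ?case
  proof (cases "x < c")
    case True
    have "{y \<in> set (x # xs). y < c} = insert x {y \<in> set xs. y < c}" using True by auto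
    moreover have "x \<notin> set xs" using Cons.prems(1) by auto
    ultimately have "rank c (set (x # xs)) = Suc (rank c (set xs))" by (simp add: rank_def)
    then show ?thesis using True Cons by (cases k) auto
  next
    case False
    have "\<not> y < c" if "y \<in> set (x # xs)" for y using that False Cons.prems(1) by auto
    then have "{y \<in> set (x # xs). y < c} = {}" by blast
    then have "rank c (set (x # xs)) = 0" unfolding rank_def by (simp only: card.empty)
    moreover have "\<not> (x # xs) ! k < c" using \<open>\<And>y. y \<in> set (x # xs) \<Longrightarrow> \<not> y < c\<close> nth_mem[OF Cons.prems(2)] .
    ultimately show ?thesis by simp
  qed
qed simp

lemma rank_le_length: "rank c (set xs) \<le> length xs"
  unfolding rank_def using card_length[of xs] card_mono[of "set xs" "{x \<in> set xs. x < c}"] by auto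

text \<open>If the entry of \<open>ys\<close> in some row is smaller than the entry \<open>c\<close> of \<open>xs\<close> in that row, then more
letters of \<open>ys\<close> than of \<open>xs\<close>, counted with the offset, lie below \<open>c\<close>, and conversely.  The bounds on the
starting and ending rows hold for adjacent columns of a skew shape.\<close>

lemma rows_iff_dominates:
  assumes xs: "sorted_wrt (<) xs" and ys: "sorted_wrt (<) ys"
    and s: "s' \<le> s" "s' + length ys \<le> s + length xs"
  shows "(\<forall>i. s \<le> i \<and> i < s + length xs \<and> s' \<le> i \<and> i < s' + length ys \<longrightarrow> xs ! (i - s) \<le> ys ! (i - s'))
    \<longleftrightarrow> dominates (s - s') (set xs) (set ys)"
proof
  assume rows: "\<forall>i. s \<le> i \<and> i < s + length xs \<and> s' \<le> i \<and> i < s' + length ys \<longrightarrow> xs ! (i - s) \<le> ys ! (i - s')"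
  show "dominates (s - s') (set xs) (set ys)"
    unfolding dominates_def
  proof (intro allI, rule ccontr)
    fix c assume *: "\<not> rank c (set ys) \<le> s - s' + rank c (set xs)"
    let ?r = "rank c (set xs)"
    let ?i = "s + ?r"
    have i: "?i - s' < rank c (set ys)" using * s by simp
    then have len: "?i < s' + length ys" using rank_le_length[of c ys] s by linarith
    then have "?r < length xs" using s by linarith
    then have "xs ! ?r \<le> ys ! (?i - s')" using rows[rule_format, of ?i] s len by simp
    moreover have "ys ! (?i - s') < c"
      using i len s by (subst nth_less_iff_rank[OF ys]) auto
    ultimately have "xs ! ?r < c" by simp
    then show False using nth_less_iff_rank[OF xs \<open>?r < length xs\<close>] by simp
  qed
next
  assume dom: "dominates (s - s') (set xs) (set ys)"
  show "\<forall>i. s \<le> i \<and> i < s + length xs \<and> s' \<le> i \<and> i < s' + length ys \<longrightarrow> xs ! (i - s) \<le> ys ! (i - s')"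
  proof (intro allI impI, rule ccontr)
    fix i assume i: "s \<le> i \<and> i < s + length xs \<and> s' \<le> i \<and> i < s' + length ys" and "\<not> xs ! (i - s) \<le> ys ! (i - s')"
    let ?c = "xs ! (i - s)"
    have "ys ! (i - s') < ?c" using \<open>\<not> _\<close> by simp
    then have "i - s' < rank ?c (set ys)" using i nth_less_iff_rank[OF ys, of "i - s'"] by auto
    moreover have "i - s < length xs" using i by linarith
    then have "rank ?c (set xs) \<le> i - s" using nth_less_iff_rank[OF xs, of "i - s" ?c] by (simp add: not_less)
    moreover have "rank ?c (set ys) \<le> s - s' + rank ?c (set xs)" using dom by (simp add: dominates_def)
    ultimately show False using i s by linarith
  qed
qed

text \<open>The conjugate partition.\<close>

definition height :: "(nat \<Rightarrow> nat) \<Rightarrow> nat \<Rightarrow> nat" where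
  "height lam j = card {i. j < lam i}"

lemma less_height_iff:
  assumes "is_partition lam"
  shows "i < height lam j \<longleftrightarrow> j < lam i"
proof -
  have anti: "lam i' \<le> lam i" if "i \<le> i'" for i i' using assms that by (auto simp: is_partition_def antimono_def)
  have fin: "finite {i. j < lam i}"
    by (rule finite_subset[of _ "{i. lam i \<noteq> 0}"]) (use assms in \<open>auto simp: is_partition_def\<close>)
  show ?thesis
  proof
    assume "j < lam i"
    then have "j < lam i'" if "i' \<le> i" for i' using anti[OF that] by simp
    then have "{..i} \<subseteq> {i. j < lam i}" by auto
    then have "card {..i} \<le> height lam j" unfolding height_def by (rule card_mono[OF fin])
    then show "i < height lam j" by simp
  next
    assume i: "i < height lam j"
    show "j < lam i"
    proof (rule ccontr)
      assume "\<not> j < lam i"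
      moreover have "i' < i" if "j < lam i'" "\<not> j < lam i" for i'
        using that anti[of i i'] by linarith
      ultimately have "{i. j < lam i} \<subseteq> {..<i}" by auto
      then have "height lam j \<le> card {..<i}" unfolding height_def by (intro card_mono) auto
      then show False using i by simp
    qed
  qed
qed

lemma skew_shape_iff:
  assumes "is_partition lam" "is_partition mu"
  shows "(i, j) \<in> skew_shape lam mu \<longleftrightarrow> height mu j \<le> i \<and> i < height lam j"
proof -
  have "mu i \<le> j \<longleftrightarrow> height mu j \<le> i"
    using less_height_iff[OF assms(2), of i j] by linarith
  then show ?thesis using less_height_iff[OF assms(1), of i j] by (simp add: skew_shape_def)
qed

lemma height_antimono:
  assumes "is_partition lam" "j \<le> j'"
  shows "height lam j' \<le> height lam j"
proof (rule ccontr)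
  assume "\<not> height lam j' \<le> height lam j"
  then have "j' < lam (height lam j)" using less_height_iff[OF assms(1)] by (simp add: not_le)
  then have "j < lam (height lam j)" using assms(2) by simp
  then have "height lam j < height lam j" using less_height_iff[OF assms(1), of "height lam j" j] by blast
  then show False by simp
qed

lemma height_mono:
  assumes "is_partition lam" "is_partition mu" "\<forall>i. mu i \<le> lam i"
  shows "height mu j \<le> height lam j"
proof (rule ccontr)
  assume "\<not> height mu j \<le> height lam j"
  then have "j < mu (height lam j)" using less_height_iff[OF assms(2)] by (simp add: not_le)
  then have "j < lam (height lam j)" using assms(3) less_le_trans by blast
  then show False using less_height_iff[OF assms(1), of "height lam j" j] by blast
qed

lemma column_eq:
  assumes "is_partition lam" "is_partition mu"
  shows "column (skew_shape lam mu) T j = map (\<lambda>i. T (i, j)) [height mu j..<height lam j]"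
proof -
  have "{i. (i, j) \<in> skew_shape lam mu} = set [height mu j..<height lam j]"
    by (auto simp: skew_shape_iff[OF assms])
  then show ?thesis unfolding column_def by (simp only: set_upt sorted_list_of_set_range)
qed

text \<open>Rows of a skew shape are intervals, so it is enough to compare adjacent columns.\<close>

lemma semistandard_iff:
  assumes lam: "is_partition lam" and mu: "is_partition mu" and sub: "\<forall>i. mu i \<le> lam i"
  defines "S \<equiv> skew_shape lam mu"
  shows "semistandard S T \<longleftrightarrow> (\<forall>j. sorted_wrt (<) (column S T j)) \<and>
    (\<forall>j. dominates (height mu j - height mu (Suc j)) (set (column S T j)) (set (column S T (Suc j))))"
proof -
  note mem = skew_shape_iff[OF lam mu, folded S_def]
  note col = column_eq[OF lam mu, folded S_def]
  have vert: "(\<forall>j. sorted_wrt (<) (column S T j)) \<longleftrightarrow>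
      (\<forall>i i' j. (i, j) \<in> S \<and> (i', j) \<in> S \<and> i < i' \<longrightarrow> T (i, j) < T (i', j))"
  proof -
    have "sorted_wrt (<) (column S T j) \<longleftrightarrow>
        (\<forall>i i'. (i, j) \<in> S \<and> (i', j) \<in> S \<and> i < i' \<longrightarrow> T (i, j) < T (i', j))" for j
    proof
      assume s: "sorted_wrt (<) (column S T j)"
      show "\<forall>i i'. (i, j) \<in> S \<and> (i', j) \<in> S \<and> i < i' \<longrightarrow> T (i, j) < T (i', j)"
      proof (intro allI impI)
        fix i i' assume "(i, j) \<in> S \<and> (i', j) \<in> S \<and> i < i'"
        then show "T (i, j) < T (i', j)"
          using sorted_wrt_nth_less[OF s, of "i - height mu j" "i' - height mu j"] by (auto simp: mem col)
      qed
    next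
      assume less: "\<forall>i i'. (i, j) \<in> S \<and> (i', j) \<in> S \<and> i < i' \<longrightarrow> T (i, j) < T (i', j)"
      show "sorted_wrt (<) (column S T j)"
        unfolding sorted_wrt_iff_nth_less by (auto simp: col mem intro!: less[rule_format])
    qed
    then show ?thesis by blast
  qed
  have horiz: "(\<forall>i. (i, j) \<in> S \<and> (i, Suc j) \<in> S \<longrightarrow> T (i, j) \<le> T (i, Suc j)) \<longleftrightarrow>
      dominates (height mu j - height mu (Suc j)) (set (column S T j)) (set (column S T (Suc j)))"
    if "\<forall>j. sorted_wrt (<) (column S T j)" for j
  proof -
    have le: "height mu j \<le> height lam j" "height mu (Suc j) \<le> height lam (Suc j)"
      "height lam (Suc j) \<le> height lam j"
      using height_mono[OF lam mu sub] height_antimono[OF lam] by simp_all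
    have "(\<forall>i. (i, j) \<in> S \<and> (i, Suc j) \<in> S \<longrightarrow> T (i, j) \<le> T (i, Suc j)) \<longleftrightarrow>
      (\<forall>i. height mu j \<le> i \<and> i < height mu j + length (column S T j) \<and>
         height mu (Suc j) \<le> i \<and> i < height mu (Suc j) + length (column S T (Suc j)) \<longrightarrow>
         column S T j ! (i - height mu j) \<le> column S T (Suc j) ! (i - height mu (Suc j)))"
      using le by (auto simp: mem col)
    also have "\<dots> \<longleftrightarrow> dominates (height mu j - height mu (Suc j)) (set (column S T j)) (set (column S T (Suc j)))"
      using that le height_antimono[OF mu, of j "Suc j"] by (intro rows_iff_dominates) (auto simp: col)
    finally show ?thesis .
  qed
  have rows: "(\<forall>i j j'. (i, j) \<in> S \<and> (i, j') \<in> S \<and> j < j' \<longrightarrow> T (i, j) \<le> T (i, j')) \<longleftrightarrow>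
      (\<forall>j i. (i, j) \<in> S \<and> (i, Suc j) \<in> S \<longrightarrow> T (i, j) \<le> T (i, Suc j))"
  proof (intro iffI allI impI)
    fix i j j' assume adj: "\<forall>j i. (i, j) \<in> S \<and> (i, Suc j) \<in> S \<longrightarrow> T (i, j) \<le> T (i, Suc j)"
      and "(i, j) \<in> S \<and> (i, j') \<in> S \<and> j < j'"
    then have *: "(i, j) \<in> S" "(i, j') \<in> S" "j \<le> j'" by auto
    have between: "(i, k) \<in> S" if "j \<le> k" "k \<le> j'" for k
      using that *(1,2) by (auto simp: S_def skew_shape_def)
    from *(3) between show "T (i, j) \<le> T (i, j')"
    proof (induction j' rule: dec_induct)
      case (step k)
      then have "T (i, j) \<le> T (i, k)" "T (i, k) \<le> T (i, Suc k)" using adj by auto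
      then show ?case by (rule order_trans)
    qed simp
  qed auto
  show ?thesis
    unfolding semistandard_def rows vert[symmetric] using horiz by blast
qed

section \<open>Tableaux as chains of column sets\<close>

lemma height_double: "height (\<lambda>i. 2 * lam i) j = height lam (j div 2)"
proof -
  have "j < 2 * x \<longleftrightarrow> j div 2 < x" for x :: nat by linarith
  then show ?thesis by (simp add: height_def)
qed

lemma is_partition_double: "is_partition lam \<Longrightarrow> is_partition (\<lambda>i. 2 * lam i)"
  by (auto simp: is_partition_def antimono_def)

text \<open>Columns \<open>2 * j\<close> and \<open>2 * j + 1\<close> of the split form occupy the same rows and satisfy the row
condition automatically, because passing from \<open>C\<close> to \<open>lC\<close> lowers letters and passing to \<open>rC\<close> raises
them.  For the same reason the row condition on the tableau itself follows from the one between \<open>rC\<close>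
and the left column of the next column.\<close>

lemma SP_iff:
  assumes lam: "is_partition lam" and mu: "is_partition mu" and sub: "\<forall>i. mu i \<le> lam i"
  defines "S \<equiv> skew_shape lam mu"
  shows "T \<in> SP m lam mu \<longleftrightarrow> T \<in> S \<rightarrow>\<^sub>E alphabet m \<and> (\<forall>j. admissible m (column S T j)) \<and>
    (\<forall>j. dominates (height mu j - height mu (Suc j))
       (right_set m (set (column S T j))) (left_set m (set (column S T (Suc j)))))"
proof (cases "\<forall>j. admissible m (column S T j)")
  case adm: True
  let ?C = "column S T"
  let ?S2 = "skew_shape (\<lambda>i. 2 * lam i) (\<lambda>i. 2 * mu i)"
  let ?lr = "\<lambda>j. (if even j then left_column m else right_column m) (?C (j div 2))"
  note C = adm[rule_format]
  have adm_set: "admissible_set m (set (?C j))" for j using C by (simp add: admissible_iff)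
  have fin: "finite (left_set m (set (?C j)))" "finite (right_set m (set (?C j)))" for j
    using left_set_alphabet[OF adm_set] right_set_alphabet[OF adm_set] finite_subset[OF _ finite_alphabet]
    by blast+
  have len: "length (?C j) = height lam j - height mu j" for j
    by (simp add: S_def column_eq[OF lam mu])
  have card: "card (set (?C j)) = length (?C j)" for j
    using C[of j] by (intro distinct_card strict_sorted_distinct) (simp add: admissible_iff)
  have len_lr: "length (?lr j) = height lam (j div 2) - height mu (j div 2)" for j
    using fin card by (simp add: left_column_eq[OF C] right_column_eq[OF C] card_left_set[OF adm_set]
        card_right_set[OF adm_set] len)
  have col2: "column ?S2 (split_form m S T) j = ?lr j" for j
  proof (rule nth_equalityI)
    show "length (column ?S2 (split_form m S T) j) = length (?lr j)"
      unfolding len_lr by (simp add: column_eq is_partition_double lam mu height_double)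
    fix i assume "i < length (column ?S2 (split_form m S T) j)"
    then have i: "i < height lam (j div 2) - height mu (j div 2)"
      by (simp add: column_eq is_partition_double lam mu height_double)
    let ?i = "height mu (j div 2) + i"
    have "{i'. i' < ?i \<and> (i', j div 2) \<in> S} = {height mu (j div 2)..<?i}"
      using i by (auto simp: S_def skew_shape_iff[OF lam mu])
    then have "split_form m S T (?i, j) = ?lr j ! i" by (simp add: split_form_def)
    then show "column ?S2 (split_form m S T) j ! i = ?lr j ! i"
      using i by (simp add: column_eq is_partition_double lam mu height_double)
  qed
  have sorted: "sorted_wrt (<) (?lr j)" for j
    by (simp add: left_column_eq[OF C] right_column_eq[OF C])
  have set_l: "set (left_column m (?C j)) = left_set m (set (?C j))"
    and set_r: "set (right_column m (?C j)) = right_set m (set (?C j))" for j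
    using fin by (simp_all add: left_column_eq[OF C] right_column_eq[OF C])
  have "semistandard ?S2 (split_form m S T) \<longleftrightarrow>
      (\<forall>j. dominates (height mu (j div 2) - height mu (Suc j div 2)) (set (?lr j)) (set (?lr (Suc j))))"
    using sorted sub
    by (subst semistandard_iff) (simp_all add: is_partition_double lam mu col2 height_double)
  also have "\<dots> \<longleftrightarrow> (\<forall>j. dominates (height mu j - height mu (Suc j))
       (right_set m (set (?C j))) (left_set m (set (?C (Suc j)))))" (is "?l \<longleftrightarrow> ?r")
  proof
    assume l: ?l
    show ?r
    proof
      fix j show "dominates (height mu j - height mu (Suc j)) (right_set m (set (?C j))) (left_set m (set (?C (Suc j))))"
        using l[rule_format, of "2 * j + 1"] by (simp add: set_l set_r)
    qed
  next
    assume r: ?r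
    show ?l
    proof
      fix j
      show "dominates (height mu (j div 2) - height mu (Suc j div 2)) (set (?lr j)) (set (?lr (Suc j)))"
      proof (cases "even j")
        case True
        have "dominates 0 (left_set m (set (?C (j div 2)))) (right_set m (set (?C (j div 2))))"
          unfolding dominates_def using order_trans[OF rank_right_set[OF C] rank_left_set[OF C]] by simp
        then show ?thesis using True by (simp add: set_l set_r)
      next
        case False
        then show ?thesis using r by (simp add: set_l set_r)
      qed
    qed
  qed
  finally have split: "semistandard ?S2 (split_form m S T) \<longleftrightarrow> ?r" .
  have "semistandard S T" if ?r
    unfolding S_def
  proof (subst semistandard_iff[OF lam mu sub], fold S_def, intro conjI allI)
    fix j
    show "sorted_wrt (<) (?C j)" using C by (simp add: admissible_iff)
    show "dominates (height mu j - height mu (Suc j)) (set (?C j)) (set (?C (Suc j)))"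
      unfolding dominates_def
    proof
      fix c
      have "rank c (set (?C (Suc j))) \<le> rank c (left_set m (set (?C (Suc j))))" by (rule rank_left_set[OF C])
      also have "\<dots> \<le> height mu j - height mu (Suc j) + rank c (right_set m (set (?C j)))"
        using that by (simp add: dominates_def)
      also have "\<dots> \<le> height mu j - height mu (Suc j) + rank c (set (?C j))"
        using rank_right_set[OF C] by simp
      finally show "rank c (set (?C (Suc j))) \<le> height mu j - height mu (Suc j) + rank c (set (?C j))" .
    qed
  qed
  then show ?thesis using split adm by (auto simp: SP_def S_def)
next
  case False
  then show ?thesis by (auto simp: SP_def S_def)
qed

definition column_sets :: "nat \<Rightarrow> (nat \<times> nat) set \<Rightarrow> filling \<Rightarrow> letter set list" where
  "column_sets K S T = map (\<lambda>j. set (column S T j)) [0..<K]"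

lemma column_empty:
  assumes "is_partition lam" "is_partition mu" "lam 0 \<le> j"
  shows "column (skew_shape lam mu) T j = []"
  using less_height_iff[OF assms(1), of 0 j] assms(3) by (simp add: column_eq[OF assms(1,2)])

lemma rank_empty [simp]: "rank c {} = 0"
  by (simp add: rank_def)

lemma empty_column: "admissible m []" "left_set m {} = {}"
proof -
  have g: "greedy (free_letters m {}) (Suc m) (descending (doubles {})) []"
    by (simp add: doubles_def descending_def)
  then show "admissible m []" by (auto simp: admissible_iff admissible_set_def)
  show "left_set m {} = {}" by (simp add: left_set_def splitting_eqI[OF g])
qed

text \<open>A column of a semistandard filling is the increasing list of its entries, so the column sets
determine the filling, and every chain of column sets arises.\<close>

lemma bij_column_sets:
  assumes lam: "is_partition lam" and mu: "is_partition mu" and sub: "\<forall>i. mu i \<le> lam i"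
  defines "S \<equiv> skew_shape lam mu"
  shows "bij_betw (column_sets (lam 0) S) (SP m lam mu)
    (column_chains m (lam 0) (\<lambda>j. height mu j - height mu (Suc j)) (\<lambda>j. height lam j - height mu j))"
    (is "bij_betw ?f _ (column_chains m ?K ?\<delta> ?h)")
proof -
  note col = column_eq[OF lam mu, folded S_def]
  note mem = skew_shape_iff[OF lam mu, folded S_def]
  note SP = SP_iff[OF lam mu sub, folded S_def]
  \<comment> \<open>The inverse map; outside the shape it has the default value that extensional functions have there.\<close>
  define fill where "fill cs = (\<lambda>(i, j). if (i, j) \<in> S then sorted_list_of_set (cs ! j) ! (i - height mu j) else undefined)"
    for cs :: "letter set list"
  have inK: "j < ?K" if "(i, j) \<in> S" for i j
    using that lam antimonoD[of lam 0 i] by (auto simp: S_def skew_shape_def is_partition_def)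
  have to: "?f T \<in> column_chains m ?K ?\<delta> ?h \<and> fill (?f T) = T" if T: "T \<in> SP m lam mu" for T
  proof
    have adm: "admissible m (column S T j)" for j using T SP by blast
    then have card: "card (set (column S T j)) = ?h j" for j
      using strict_sorted_distinct[of "column S T j"] distinct_card[of "column S T j"]
      by (simp add: admissible_iff) (simp add: col)
    show "?f T \<in> column_chains m ?K ?\<delta> ?h"
      using T adm card by (simp add: column_chains_def column_sets_def SP admissible_iff)
    show "fill (?f T) = T"
    proof
      fix b :: "nat \<times> nat"
      obtain i j where b: "b = (i, j)" by (cases b)
      show "fill (?f T) b = T b"
      proof (cases "(i, j) \<in> S")
        case True
        have "sorted_list_of_set (set (column S T j)) = column S T j"
          using adm[of j] by (simp add: admissible_iff strict_sorted_iff sorted_list_of_set.idem_if_sorted_distinct)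
        then show ?thesis using True inK[OF True] by (auto simp: b fill_def column_sets_def col mem)
      next
        case False
        then show ?thesis using T by (auto simp: b fill_def SP PiE_def extensional_def)
      qed
    qed
  qed
  have inverse: "fill cs \<in> SP m lam mu \<and> ?f (fill cs) = cs" if cs: "cs \<in> column_chains m ?K ?\<delta> ?h" for cs
  proof -
    have cs': "length cs = ?K" "\<And>j. j < ?K \<Longrightarrow> admissible_set m (cs ! j)" "\<And>j. j < ?K \<Longrightarrow> card (cs ! j) = ?h j"
      "\<And>j. Suc j < ?K \<Longrightarrow> dominates (?\<delta> j) (right_set m (cs ! j)) (left_set m (cs ! Suc j))"
      using cs by (auto simp: column_chains_def)
    have fin: "finite (cs ! j)" and alph: "cs ! j \<subseteq> alphabet m" if "j < ?K" for j
      using cs'(2)[OF that] finite_subset[OF _ finite_alphabet] by (auto simp: admissible_set_def)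
    have colj: "column S (fill cs) j = (if j < ?K then sorted_list_of_set (cs ! j) else [])" for j
    proof (cases "j < ?K")
      case True
      have "column S (fill cs) j = sorted_list_of_set (cs ! j)"
      proof (rule nth_equalityI)
        show "length (column S (fill cs) j) = length (sorted_list_of_set (cs ! j))"
          using True cs'(3) by (simp add: col)
        fix i assume "i < length (column S (fill cs) j)"
        then have "height mu j + i < height lam j" "i < length [height mu j..<height lam j]" by (auto simp: col)
        then show "column S (fill cs) j ! i = sorted_list_of_set (cs ! j) ! i"
          by (simp add: col fill_def mem)
      qed
      then show ?thesis using True by simp
    next
      case False
      then show ?thesis using column_empty[OF lam mu] by (simp add: S_def)
    qed
    have setcol: "set (column S (fill cs) j) = (if j < ?K then cs ! j else {})" for j
      by (simp add: colj fin)
    have "fill cs b \<in> alphabet m" if b: "b \<in> S" for b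
    proof -
      obtain i j where ij: "b = (i, j)" by (cases b)
      then have "i \<in> set [height mu j..<height lam j]" using b by (simp add: mem)
      then have "fill cs b \<in> set (column S (fill cs) j)" unfolding col ij by simp
      then show ?thesis using setcol[of j] alph inK b ij by auto
    qed
    then have "fill cs \<in> S \<rightarrow>\<^sub>E alphabet m" by (auto simp: PiE_def extensional_def fill_def)
    moreover have "admissible m (column S (fill cs) j)" for j
      using cs'(2)[of j] fin[of j] empty_column(1) by (auto simp: admissible_iff colj)
    moreover have "dominates (?\<delta> j) (right_set m (set (column S (fill cs) j))) (left_set m (set (column S (fill cs) (Suc j))))" for j
      using cs'(4)[of j] by (simp add: setcol empty_column(2)) (simp add: dominates_def)
    ultimately have "fill cs \<in> SP m lam mu" by (simp add: SP)
    moreover have "?f (fill cs) = cs"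
      by (rule nth_equalityI) (simp_all add: column_sets_def cs'(1) setcol)
    ultimately show ?thesis by blast
  qed
  show ?thesis using to inverse by (intro bij_betw_byWitness[where f' = fill]) auto
qed

lemma finite_skew_shape:
  assumes "is_partition lam" "is_partition mu"
  shows "finite (skew_shape lam mu)"
proof (rule finite_subset)
  show "skew_shape lam mu \<subseteq> {..<height lam 0} \<times> {..<lam 0}"
  proof clarify
    fix i j assume ij: "(i, j) \<in> skew_shape lam mu"
    then have "lam i > j" by (simp add: skew_shape_def)
    moreover have "lam i \<le> lam 0" using assms(1) antimonoD[of lam 0 i] by (simp add: is_partition_def)
    ultimately show "i \<in> {..<height lam 0} \<and> j \<in> {..<lam 0}" using less_height_iff[OF assms(1), of i 0] by auto
  qed
qed simp

lemma letter_count_column_sets: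
  assumes lam: "is_partition lam" and mu: "is_partition mu" and sub: "\<forall>i. mu i \<le> lam i"
  defines "S \<equiv> skew_shape lam mu"
  assumes T: "T \<in> SP m lam mu"
  shows "letter_count S T x = (\<Sum>X\<leftarrow>column_sets (lam 0) S T. of_bool (x \<in> X))"
proof -
  note col = column_eq[OF lam mu, folded S_def]
  note mem = skew_shape_iff[OF lam mu, folded S_def]
  have inset: "T (i, j) \<in> set (column S T j)" if "(i, j) \<in> S" for i j
    using that by (auto simp: col mem)
  have inK: "j < lam 0" if "(i, j) \<in> S" for i j
    using that lam antimonoD[of lam 0 i] by (auto simp: S_def skew_shape_def is_partition_def)
  have "bij_betw snd {b \<in> S. T b = x} {j \<in> {..<lam 0}. x \<in> set (column S T j)}"
    unfolding bij_betw_def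
  proof
    show "inj_on snd {b \<in> S. T b = x}"
    proof (rule inj_onI)
      fix b b' assume "b \<in> {b \<in> S. T b = x}" "b' \<in> {b \<in> S. T b = x}" "snd b = snd b'"
      then obtain i i' j where b: "b = (i, j)" "b' = (i', j)" and *: "(i, j) \<in> S" "(i', j) \<in> S"
        and eq: "T (i, j) = T (i', j)"
        by (cases b; cases b') auto
      have "semistandard S T" using T by (simp add: SP_def S_def)
      then have "i < i' \<Longrightarrow> T (i, j) < T (i', j)" "i' < i \<Longrightarrow> T (i', j) < T (i, j)"
        using * unfolding semistandard_def by blast+
      then have "i = i'" using eq by (metis less_irrefl linorder_neqE_nat)
      then show "b = b'" by (simp add: b)
    qed
    show "snd ` {b \<in> S. T b = x} = {j \<in> {..<lam 0}. x \<in> set (column S T j)}"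
    proof (intro equalityI subsetI)
      fix j assume "j \<in> snd ` {b \<in> S. T b = x}"
      then show "j \<in> {j \<in> {..<lam 0}. x \<in> set (column S T j)}" using inset inK by auto
    next
      fix j assume "j \<in> {j \<in> {..<lam 0}. x \<in> set (column S T j)}"
      then obtain i where "(i, j) \<in> S" "T (i, j) = x" by (auto simp: col mem)
      then show "j \<in> snd ` {b \<in> S. T b = x}" by force
    qed
  qed
  then have "letter_count S T x = card {j \<in> {..<lam 0}. x \<in> set (column S T j)}"
    unfolding letter_count_def by (rule bij_betw_same_card)
  also have "\<dots> = (\<Sum>j\<in>{..<lam 0}. of_bool (x \<in> set (column S T j)))"
    by (simp add: sum_of_bool_eq Int_def)
  also have "\<dots> = (\<Sum>X\<leftarrow>column_sets (lam 0) S T. of_bool (x \<in> X))"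
    by (simp add: column_sets_def comp_def interv_sum_list_conv_sum_set_nat atLeast0LessThan)
  finally show ?thesis .
qed

lemma wt_eq_chain_weight:
  assumes "is_partition lam" "is_partition mu" "\<forall>i. mu i \<le> lam i" "T \<in> SP m lam mu"
  shows "wt m (skew_shape lam mu) T = chain_weight m (column_sets (lam 0) (skew_shape lam mu) T)"
proof -
  have "int (\<Sum>X\<leftarrow>cs. of_bool (P X)) - int (\<Sum>X\<leftarrow>cs. of_bool (Q X))
      = (\<Sum>X\<leftarrow>cs. of_bool (P X) - of_bool (Q X))" for cs :: "letter set list" and P Q
    by (induction cs) auto
  then show ?thesis
    by (simp only: wt_def chain_weight_def letter_count_column_sets[OF assms] balance_def)
qed

theorem card_SP_swap:
  assumes part: "is_partition lam" "is_partition mu" "\<forall>i. mu i \<le> lam i" and u: "length u + 2 = m"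
  shows "card {T \<in> SP m lam mu. wt m (skew_shape lam mu) T = u @ [x, y]}
       = card {T \<in> SP m lam mu. wt m (skew_shape lam mu) T = u @ [y, x]}"
proof -
  let ?f = "column_sets (lam 0) (skew_shape lam mu)"
  let ?Q = "column_chains m (lam 0) (\<lambda>j. height mu j - height mu (Suc j)) (\<lambda>j. height lam j - height mu j)"
  have "card {T \<in> SP m lam mu. wt m (skew_shape lam mu) T = w} = card {cs \<in> ?Q. chain_weight m cs = w}" for w
  proof (rule bij_betw_same_card)
    show "bij_betw ?f {T \<in> SP m lam mu. wt m (skew_shape lam mu) T = w} {cs \<in> ?Q. chain_weight m cs = w}"
      unfolding bij_betw_def
    proof
      show "inj_on ?f {T \<in> SP m lam mu. wt m (skew_shape lam mu) T = w}"
        using bij_column_sets[OF part, of m] by (auto simp: bij_betw_def inj_on_def)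
      have "?f ` SP m lam mu = ?Q" using bij_column_sets[OF part, of m] by (simp add: bij_betw_def)
      then show "?f ` {T \<in> SP m lam mu. wt m (skew_shape lam mu) T = w} = {cs \<in> ?Q. chain_weight m cs = w}"
        using wt_eq_chain_weight[OF part, of _ m] by fastforce
    qed
  qed
  then show ?thesis using card_chains_swap[OF u] by simp
qed

section \<open>Weights, exponents and the action\<close>

lemma card_skew_shape:
  assumes lam: "is_partition lam" and mu: "is_partition mu" and sub: "\<forall>i. mu i \<le> lam i"
  shows "card (skew_shape lam mu) = partition_size lam - partition_size mu"
proof -
  let ?I = "{i. lam i \<noteq> 0}"
  have fin: "finite ?I" using lam by (simp add: is_partition_def)
  have "skew_shape lam mu = (SIGMA i:?I. {mu i..<lam i})" by (auto simp: skew_shape_def)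
  then have "card (skew_shape lam mu) = (\<Sum>i\<in>?I. lam i - mu i)" using fin by simp
  also have "\<dots> = (\<Sum>i\<in>?I. lam i) - (\<Sum>i\<in>?I. mu i)" using sub by (intro sum_subtractf_nat) simp
  also have "(\<Sum>i\<in>?I. mu i) = (\<Sum>i | mu i \<noteq> 0. mu i)"
  proof (rule sum.mono_neutral_right[OF fin])
    have "lam i \<noteq> 0" if "mu i \<noteq> 0" for i using that sub[rule_format, of i] by simp
    then show "{i. mu i \<noteq> 0} \<subseteq> ?I" by blast
  qed simp
  finally show ?thesis by (simp add: partition_size_def)
qed

lemma sum_letter_count:
  assumes "finite S" "T \<in> S \<rightarrow> alphabet m"
  shows "(\<Sum>i=1..m. letter_count S T (Unbarred i) + letter_count S T (Barred i)) = card S"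
proof -
  have "card S = (\<Sum>x\<in>alphabet m. \<Sum>b\<in>{b \<in> S. T b = x}. 1)"
    using assms finite_alphabet by (subst sum.group) auto
  also have "\<dots> = (\<Sum>x\<in>alphabet m. letter_count S T x)"
    by (simp add: letter_count_def)
  also have "\<dots> = (\<Sum>x\<in>Unbarred ` {1..m}. letter_count S T x) + (\<Sum>x\<in>Barred ` {1..m}. letter_count S T x)"
    unfolding alphabet_def by (intro sum.union_disjoint) auto
  also have "\<dots> = (\<Sum>i=1..m. letter_count S T (Unbarred i)) + (\<Sum>i=1..m. letter_count S T (Barred i))"
    by (simp add: sum.reindex inj_on_def)
  finally show ?thesis by (simp add: sum.distrib)
qed

lemma length_wt: "length (wt m S T) = m"
  by (simp add: wt_def)

lemma nth_wt: "i < m \<Longrightarrow>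
    wt m S T ! i = int (letter_count S T (Unbarred (Suc i))) - int (letter_count S T (Barred (Suc i)))"
  by (simp add: wt_def del: upt_Suc)

lemma wt_in_weights:
  assumes "finite S" "T \<in> S \<rightarrow> alphabet m" "card S = n" "odd n"
  shows "wt m S T \<in> weights m n"
proof -
  let ?a = "\<lambda>i. letter_count S T (Unbarred (Suc i))" and ?b = "\<lambda>i. letter_count S T (Barred (Suc i))"
  have n: "(\<Sum>i<m. ?a i + ?b i) = n"
    using sum_letter_count[OF assms(1,2)] assms(3)
    by (simp add: sum.atLeast1_atMost_eq)
  have "(\<Sum>x\<leftarrow>wt m S T. \<bar>x\<bar>) = (\<Sum>i<m. \<bar>int (?a i) - int (?b i)\<bar>)"
    by (simp add: sum_list_sum_nth length_wt nth_wt atLeast0LessThan)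
  also have "\<dots> \<le> (\<Sum>i<m. int (?a i + ?b i))" by (intro sum_mono) auto
  also have "\<dots> = int n" unfolding n[symmetric] by simp
  finally have le: "(\<Sum>x\<leftarrow>wt m S T. \<bar>x\<bar>) \<le> int n" .
  have "sum_list (wt m S T) = (\<Sum>i<m. int (?a i) - int (?b i))"
    by (simp add: sum_list_sum_nth length_wt nth_wt atLeast0LessThan)
  also have "\<dots> = (\<Sum>i<m. int (?a i + ?b i)) - 2 * (\<Sum>i<m. int (?b i))"
    by (simp add: sum_distrib_left flip: sum_subtractf)
  also have "(\<Sum>i<m. int (?a i + ?b i)) = int n" unfolding n[symmetric] by simp
  finally have "odd (sum_list (wt m S T))" using assms(4) by simp
  then show ?thesis using le by (simp add: weights_def length_wt)
qed

text \<open>An entry \<open>i\<close> contributes \<open>2 * (i - 1) + 1 = 2 * i - 1\<close> and a barred entry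
\<open>2 * (2 * m - i) + 1 = 4 * m - (2 * i - 1)\<close> to \<open>2 * pwr + n\<close>, which modulo \<open>4 * m\<close> are opposite.\<close>

lemma power_pwr:
  fixes \<eta> :: complex
  assumes \<eta>: "\<eta> ^ (4 * m) = 1" "m > 0" and T: "finite S" "T \<in> S \<rightarrow> alphabet m"
  shows "\<eta> ^ card S * (\<eta> ^ 2) ^ pwr m S T = (\<Prod>i<m. (\<eta> ^ (2 * i + 1)) powi (wt m S T ! i))"
proof -
  let ?a = "\<lambda>i. letter_count S T (Unbarred (Suc i))" and ?b = "\<lambda>i. letter_count S T (Barred (Suc i))"
  have nz: "\<eta> \<noteq> 0" using \<eta> by (metis mult_pos_pos power_0_left zero_less_numeral zero_neq_one less_numeral_extra(3))
  have factor: "(\<eta> ^ (2 * i + 1)) powi (wt m S T ! i) = \<eta> ^ ((2 * i + 1) * ?a i + (4 * m - (2 * i + 1)) * ?b i)"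
    if "i < m" for i
  proof -
    have "\<eta> ^ (2 * i + 1) * \<eta> ^ (4 * m - (2 * i + 1)) = 1"
      using that \<eta>(1) by (subst power_add[symmetric]) simp
    then have "inverse (\<eta> ^ (2 * i + 1)) = \<eta> ^ (4 * m - (2 * i + 1))" by (rule inverse_unique)
    then have "(\<eta> ^ (2 * i + 1)) powi (- int (?b i)) = \<eta> ^ ((4 * m - (2 * i + 1)) * ?b i)"
      unfolding power_int_minus power_int_of_nat power_inverse[symmetric] by (simp only: power_mult)
    moreover have "(\<eta> ^ (2 * i + 1)) powi (int (?a i)) = \<eta> ^ ((2 * i + 1) * ?a i)"
      unfolding power_int_of_nat by (simp only: power_mult)
    ultimately show ?thesis
      using nz unfolding nth_wt[OF that] diff_conv_add_uminus power_add
      by (subst power_int_add) auto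
  qed
  have "(\<Sum>i<m. (2 * i + 1) * ?a i + (4 * m - (2 * i + 1)) * ?b i)
      = (\<Sum>i<m. (?a i + ?b i) + 2 * (i * ?a i + (2 * m - Suc i) * ?b i))"
  proof (rule sum.cong[OF refl])
    fix i assume "i \<in> {..<m}"
    then have "4 * m - (2 * i + 1) = 1 + 2 * (2 * m - Suc i)" by auto
    then show "(2 * i + 1) * ?a i + (4 * m - (2 * i + 1)) * ?b i
      = (?a i + ?b i) + 2 * (i * ?a i + (2 * m - Suc i) * ?b i)"
      by (simp add: algebra_simps)
  qed
  also have "\<dots> = card S + 2 * pwr m S T"
    unfolding sum_letter_count[OF T, symmetric] pwr_def
    by (simp add: sum.atLeast1_atMost_eq sum.distrib sum_distrib_left)
  finally have exponent: "(\<Sum>i<m. (2 * i + 1) * ?a i + (4 * m - (2 * i + 1)) * ?b i) = card S + 2 * pwr m S T" .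
  have "(\<Prod>i<m. (\<eta> ^ (2 * i + 1)) powi (wt m S T ! i))
      = (\<Prod>i<m. \<eta> ^ ((2 * i + 1) * ?a i + (4 * m - (2 * i + 1)) * ?b i))"
    by (intro prod.cong refl factor) simp
  also have "\<dots> = \<eta> ^ (card S + 2 * pwr m S T)"
    unfolding power_sum[symmetric] exponent ..
  finally have "(\<Prod>i<m. (\<eta> ^ (2 * i + 1)) powi (wt m S T ! i)) = \<eta> ^ (card S + 2 * pwr m S T)" .
  then show ?thesis by (simp add: power_add power_mult)
qed

lemma poly_pwr_polynomial:
  "poly (map_poly of_int (pwr_polynomial m lam mu)) (z :: complex) =
    (\<Sum>T\<in>SP m lam mu. z ^ pwr m (skew_shape lam mu) T)"
proof -
  have "map_poly of_int (pwr_polynomial m lam mu) =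
      (\<Sum>T\<in>SP m lam mu. Polynomial.monom (1 :: complex) (pwr m (skew_shape lam mu) T))"
    by (rule poly_eqI) (simp add: coeff_map_poly pwr_polynomial_def coeff_sum if_distrib cong: if_cong)
  then show ?thesis by (simp add: poly_sum poly_monom)
qed

lemma coprime_2m_odd:
  fixes m n k :: nat
  assumes p: "\<forall>p. prime p \<and> odd p \<and> p \<le> n \<longrightarrow> gcd m p = 1" and k: "odd k" "k \<le> n"
  shows "coprime (2 * m) k"
proof (rule ccontr)
  assume "\<not> coprime (2 * m) k"
  then obtain p where p': "prime p" "p dvd gcd (2 * m) k"
    using prime_factor_nat[of "gcd (2 * m) k"] by (auto simp: coprime_iff_gcd_eq_1)
  then have "p dvd 2 * m" "p dvd k" by auto
  have "odd p" using \<open>p dvd k\<close> k(1) dvd_trans by blast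
  have "p \<le> n" using \<open>p dvd k\<close> k by (meson dvd_imp_le le_trans odd_pos)
  have "\<not> p dvd 2"
  proof
    assume "p dvd 2"
    then have "p \<le> 2" by (rule dvd_imp_le) simp
    then show False using \<open>odd p\<close> prime_ge_2_nat[OF p'(1)] by simp
  qed
  then have "p dvd m" using \<open>p dvd 2 * m\<close> p'(1) prime_dvd_multD by blast
  then have "gcd m p = p" by (simp add: gcd_nat.absorb2)
  then show False using p p'(1) \<open>odd p\<close> \<open>p \<le> n\<close> by force
qed

lemma primitive_root_power_eq_1:
  assumes "primitive_root_of_unity N \<omega>" "\<omega> ^ e = 1"
  shows "N dvd e"
proof -
  have N: "N > 0" "\<omega> ^ N = 1" "\<And>k. 0 < k \<Longrightarrow> k < N \<Longrightarrow> \<omega> ^ k \<noteq> 1"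
    using assms(1) by (auto simp: primitive_root_of_unity_def)
  have "\<omega> ^ e = \<omega> ^ (N * (e div N) + e mod N)" by simp
  also have "\<dots> = \<omega> ^ (e mod N)" unfolding power_add power_mult N(2) by simp
  finally have "\<omega> ^ (e mod N) = 1" using assms(2) by simp
  then have "e mod N = 0" using N(3)[of "e mod N"] N(1) by (cases "e mod N = 0") auto
  then show ?thesis by (rule mod_0_imp_dvd)
qed

lemma inj_on_shift_weight: "inj_on shift_weight {w. length w = m}"
proof (rule inj_onI)
  fix w w' assume *: "w \<in> {w. length w = m}" "w' \<in> {w. length w = m}" "shift_weight w = shift_weight w'"
  then have "length w = length w'" by simp
  then show "w = w'" using *(3)
    by (cases w rule: rev_cases; cases w' rule: rev_cases) (auto simp: shift_weight_def)
qed

text \<open>A statistic on which \<open>g\<close> acts through a map \<open>s\<close>.\<close>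

lemma (in group_action) action_pow:
  assumes "g \<in> carrier G" "x \<in> E"
    and s: "\<And>y. y \<in> E \<Longrightarrow> f (\<phi> g y) = s (f y)"
  shows "f (\<phi> (g [^] (d::nat)) x) = (s ^^ d) (f x)"
  using assms(2)
proof (induction d arbitrary: x)
  case 0
  then show ?case using id_eq_one by (simp add: restrict_apply' flip: id_eq_one)
next
  case (Suc d)
  interpret group G using group_hom group_hom.axioms(1) by blast
  have y: "\<phi> g x \<in> E" using element_image[OF assms(1) Suc.prems] by simp
  have "\<phi> (g [^] Suc d) x = \<phi> (g [^] d) (\<phi> g x)"
    using composition_rule[OF Suc.prems, of "g [^] d" g] assms(1) by simp
  then show ?case using Suc.IH[OF y] s[OF Suc.prems] by (simp add: funpow_swap1)
qed

theorem theorem5p3: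
  fixes m n :: nat
    and lam mu :: "nat \<Rightarrow> nat"
    and G :: "('g, 'b) monoid_scheme"
    and g :: 'g
    and \<phi> :: "'g \<Rightarrow> filling \<Rightarrow> filling"
  assumes "m > 0"
    and "is_partition lam" and "is_partition mu"
    and "\<forall>i. mu i \<le> lam i"
    and "partition_length lam \<le> m"
    and "partition_size lam - partition_size mu = n" and "odd n"
    and "\<forall>p. prime p \<and> odd p \<and> p \<le> n \<longrightarrow> gcd m p = 1"
    and "group G" and "g \<in> carrier G" and "generate G {g} = carrier G"
    and "card (carrier G) = 2 * m"
    and "group_action G (SP m lam mu) \<phi>"
    and "\<forall>T \<in> SP m lam mu.
           wt m (skew_shape lam mu) (\<phi> g T) =
             (- last (wt m (skew_shape lam mu) T)) # butlast (wt m (skew_shape lam mu) T)"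
  shows "cyclic_sieving (SP m lam mu) G g \<phi> (pwr_polynomial m lam mu)"
proof -
  interpret group_action G "SP m lam mu" \<phi> by fact
  interpret group G by fact
  note part = assms(2-4)
  let ?S = "skew_shape lam mu"
  let ?Y = "SP m lam mu"
  let ?wt = "wt m ?S"
  define N where "N w = card {T \<in> ?Y. ?wt T = w}" for w
  have finS: "finite ?S" by (rule finite_skew_shape[OF part(1,2)])
  have Y: "T \<in> ?S \<rightarrow> alphabet m" if "T \<in> ?Y" for T using that by (auto simp: SP_def PiE_def)
  have finY: "finite ?Y"
    by (rule finite_subset[of _ "?S \<rightarrow>\<^sub>E alphabet m"]) (auto simp: SP_def finS finite_alphabet intro: finite_PiE)
  have cardS: "card ?S = n" using card_skew_shape[OF part] assms(6) by simp
  have weights: "?wt T \<in> weights m n" if "T \<in> ?Y" for T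
    using wt_in_weights[OF finS Y[OF that] cardS assms(7)] .
  have shift: "?wt (\<phi> g T) = shift_weight (?wt T)" if "T \<in> ?Y" for T
    using assms(14) that by (simp add: shift_weight_def)
  have coprime: "coprime (2 * m) k" if "odd k" "k \<le> n" for k
    by (rule coprime_2m_odd[OF assms(8) that])
  have finG: "finite (carrier G)" using assms(1,12) card_gt_0_iff[of "carrier G"] by simp
  have invariant: "N w = N w'" if w: "length w = m" "mset (map abs w) = mset (map abs w')" for w w'
  proof (rule shift_swap_imp_signed_permutation_invariant[OF _ _ w])
    fix w :: "int list" assume w: "length w = m" "w \<noteq> []"
    have "bij_betw (\<phi> g) {T \<in> ?Y. ?wt T = w} {T \<in> ?Y. ?wt T = shift_weight w}"
      unfolding bij_betw_def
    proof
      have bij: "inj_on (\<phi> g) ?Y" "\<phi> g ` ?Y = ?Y"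
        using inj_prop[OF assms(10)] surj_prop[OF assms(10)] by auto
      show "inj_on (\<phi> g) {T \<in> ?Y. ?wt T = w}" by (rule inj_on_subset[OF bij(1)]) auto
      show "\<phi> g ` {T \<in> ?Y. ?wt T = w} = {T \<in> ?Y. ?wt T = shift_weight w}"
      proof (intro equalityI subsetI)
        fix T assume "T \<in> \<phi> g ` {T \<in> ?Y. ?wt T = w}"
        then show "T \<in> {T \<in> ?Y. ?wt T = shift_weight w}" using bij(2) shift by auto
      next
        fix T assume T: "T \<in> {T \<in> ?Y. ?wt T = shift_weight w}"
        then obtain T' where T': "T' \<in> ?Y" "T = \<phi> g T'" using bij(2) by blast
        then have "shift_weight (?wt T') = shift_weight w" using T shift[OF T'(1)] by simp
        then have "?wt T' = w" using inj_on_shift_weight[of m] w(1) by (auto simp: length_wt dest!: inj_onD)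
        then show "T \<in> \<phi> g ` {T \<in> ?Y. ?wt T = w}" using T' by blast
      qed
    qed
    then show "N (shift_weight w) = N w" unfolding N_def by (rule bij_betw_same_card[symmetric])
  next
    fix u :: "int list" and x y assume "length u + 2 = m"
    then show "N (u @ [x, y]) = N (u @ [y, x])" unfolding N_def by (rule card_SP_swap[OF part])
  qed
  have main: "of_nat (card (invariants ?Y \<phi> (g [^]\<^bsub>G\<^esub> d))) = poly (map_poly of_int (pwr_polynomial m lam mu)) (\<omega> ^ d)"
    if \<omega>: "primitive_root_of_unity (2 * m) \<omega>" for \<omega> :: complex and d :: nat
  proof (cases "2 * m dvd d")
    case True
    then obtain e where e: "d = 2 * m * e" by blast
    have "g [^]\<^bsub>G\<^esub> (2 * m) = \<one>\<^bsub>G\<^esub>" using pow_order_eq_1[OF assms(10)] assms(12) by (simp add: Coset.order_def)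
    then have "g [^]\<^bsub>G\<^esub> d = \<one>\<^bsub>G\<^esub>" using assms(10) by (simp add: e flip: nat_pow_pow)
    then have "invariants ?Y \<phi> (g [^]\<^bsub>G\<^esub> d) = ?Y"
      by (auto simp: invariants_def simp flip: id_eq_one)
    moreover have "\<omega> ^ d = 1" using \<omega> by (simp add: e power_mult primitive_root_of_unity_def)
    ultimately show ?thesis by (simp add: poly_pwr_polynomial)
  next
    case False
    have "invariants ?Y \<phi> (g [^]\<^bsub>G\<^esub> d) = {}"
    proof (rule ccontr)
      assume "invariants ?Y \<phi> (g [^]\<^bsub>G\<^esub> d) \<noteq> {}"
      then obtain T where T: "T \<in> ?Y" "\<phi> (g [^]\<^bsub>G\<^esub> d) T = T" by (auto simp: invariants_def)
      have "(shift_weight ^^ d) (?wt T) = ?wt T"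
        using action_pow[OF assms(10) T(1), of ?wt shift_weight d] shift T(2) by simp
      moreover have "?wt T \<noteq> []" using assms(1) length_wt[of m ?S T] by (metis length_greater_0_conv)
      ultimately have dvd: "2 * int m dvd int d * (\<Sum>x\<leftarrow>?wt T. \<bar>x\<bar>)"
        using shift_funpow_fixed[of "?wt T" d] by (simp add: length_wt)
      define L where "L = nat (\<Sum>x\<leftarrow>?wt T. \<bar>x\<bar>)"
      have L: "int L = (\<Sum>x\<leftarrow>?wt T. \<bar>x\<bar>)" unfolding L_def by (intro nat_0_le sum_list_nonneg) auto
      have "odd L" "L \<le> n"
        using weights[OF T(1)] odd_sum_list_abs[of "?wt T"] by (auto simp: weights_def simp flip: L)
      moreover have "2 * m dvd d * L" using dvd unfolding L[symmetric] by (metis int_dvd_int_iff int_ops(7) of_nat_numeral)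
      ultimately show False using False coprime coprime_dvd_mult_left_iff by blast
    qed
    moreover have "(\<Sum>T\<in>?Y. (\<omega> ^ d) ^ pwr m ?S T) = 0"
    proof -
      define \<eta> where "\<eta> = csqrt \<omega> ^ d"
      have \<eta>2: "\<eta> ^ 2 = \<omega> ^ d" by (simp add: \<eta>_def power_mult[symmetric] mult.commute[of d] power_mult)
      have \<eta>4: "\<eta> ^ (4 * m) = 1"
      proof -
        have "\<eta> ^ (4 * m) = (\<eta> ^ 2) ^ (2 * m)" by (simp flip: power_mult)
        also have "\<dots> = (\<omega> ^ (2 * m)) ^ d" unfolding \<eta>2 by (simp add: mult.commute flip: power_mult)
        finally show ?thesis using \<omega> by (simp add: primitive_root_of_unity_def)
      qed
      have \<eta>0: "\<eta> \<noteq> 0" using \<eta>4 assms(1) by (auto simp: power_0_left)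
      have "(\<eta> ^ 2) powi k \<noteq> 1" if k: "odd k" "\<bar>k\<bar> \<le> int n" for k :: int
      proof
        assume "(\<eta> ^ 2) powi k = 1"
        then have "(\<omega> ^ d) ^ nat \<bar>k\<bar> = 1"
          unfolding \<eta>2 by (cases "k \<ge> 0") (auto simp: power_int_def power_inverse)
        then have "2 * m dvd d * nat \<bar>k\<bar>"
          using primitive_root_power_eq_1[OF \<omega>] by (simp add: power_mult)
        moreover have "coprime (2 * m) (nat \<bar>k\<bar>)" using k by (intro coprime) (auto simp: even_nat_iff)
        ultimately show False using False coprime_dvd_mult_left_iff by blast
      qed
      then have vanish: "(\<Sum>j<m. sym_power (\<eta> ^ (2 * j + 1)) k) = 0" if "odd k" "\<bar>k\<bar> \<le> int n" for k
        using that by (intro sum_sym_power_eq_0[OF \<eta>4 assms(1)]) auto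
      let ?mon = "\<lambda>w. \<Prod>i<m. (\<eta> ^ (2 * i + 1)) powi (w ! i)"
      have "\<eta> ^ n * (\<Sum>T\<in>?Y. (\<omega> ^ d) ^ pwr m ?S T) = (\<Sum>T\<in>?Y. ?mon (?wt T))"
        using power_pwr[OF \<eta>4 assms(1) finS Y] by (simp add: sum_distrib_left cardS \<eta>2)
      also have "\<dots> = (\<Sum>w\<in>weights m n. \<Sum>T\<in>{T \<in> ?Y. ?wt T = w}. ?mon (?wt T))"
        using weights by (intro sum.group[symmetric] finY finite_weights) auto
      also have "\<dots> = (\<Sum>w\<in>weights m n. of_nat (N w) * ?mon w)"
        by (intro sum.cong refl) (simp add: N_def)
      also have "\<dots> = 0"
        using \<eta>0 vanish invariant by (intro sum_signed_permutation_invariant_eq_0) auto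
      finally show ?thesis using \<eta>0 by simp
    qed
    ultimately show ?thesis by (simp add: poly_pwr_polynomial)
  qed
  show ?thesis
    unfolding cyclic_sieving_def assms(12) using finY finG assms(10,11,13) main by blast
qed

end
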